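(* Let $n\ge1$ be an integer and let $\mathfrak h_n$ be the Heisenberg Lie algebra of dimension $2n+1$. Its independence polynomial is $$I(\mathfrak h_n,t)=\sum_{k=0}^n\left(\binom{2n}{k}-\binom{2n}{k-2}\right)t^k.$$
   Context: Heisenberg Lie algebra: $\mathfrak h_n$ is the real Lie algebra with basis $y_1,\ldots,y_{2n},z$ whose bracket satisfies $[y_{2k-1},y_{2k}]=z$ for $k\in\{1,\ldots,n\}$, all other brackets of basis elements (up to antisymmetry) being zero. It is 2-step nilpotent, i.e. $[x,[y,w]]=0$ for all $x,y,w$. Cohomology: the Cartan-Chevalley-Eilenberg complex of a 2-step nilpotent Lie algebra $\mathfrak g$ is the exterior algebra $\mathcal C^\bullet(\mathfrak g)=\bigwedge^\bullet\mathfrak g^\vee$ of the dual of $\mathfrak g$, with differential $d$ the odd derivation determined by $d(\varphi)(x,y)=\varphi([x,y])$ for $\varphi\in\mathfrak g^\vee$, $x,y\in\mathfrak g$. $H^\bullet(\mathfrak g)$ is its cohomology. Basic cohomology: let $\pi:\mathfrak g\to\mathfrak g/[\mathfrak g,\mathfrak g]$ be the canonical quotient map. $H^\bullet_B(\mathfrak g)$ is the image of the induced linear map $\pi^\bullet:H^\bullet(\mathfrak g/[\mathfrak g,\mathfrak g])\to H^\bullet(\mathfrak g)$, and $b^k_B(\mathfrak g)=\dim H^k_B(\mathfrak g)$. Independence number and polynomial: $\alpha(\mathfrak g)$ is the largest integer $k$ such that $b^k_B(\mathfrak g)\ne0$, and $I(\mathfrak g,t)=\sum_{k=0}^{\alpha(\mathfrak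 g)}b^k_B(\mathfrak g)t^k$. Convention: $\binom{a}{j}=0$ for $j<0$. *)

theory Defs
  imports
    "HOL-Algebra.AbelCoset"
    "Jordan_Normal_Form.VS_Connect"
    "HOL-Computational_Algebra.Polynomial"
begin

record ('a, 'b) lie = "('a, 'b) module" +
  bracket :: "'b \<Rightarrow> 'b \<Rightarrow> 'b"

locale real_lie_algebra =
  vectorspace "class_ring :: real ring" g
  for g :: "(real, 'b, 'm) lie_scheme" (structure) +
  assumes bracket_closed:
      "\<lbrakk>x \<in> carrier g; y \<in> carrier g\<rbrakk> \<Longrightarrow> bracket g x y \<in> carrier g"
    and bracket_add_left:
      "\<lbrakk>x \<in> carrier g; y \<in> carrier g; w \<in> carrier g\<rbrakk>
        \<Longrightarrow> bracket g (x \<oplus> y) w = bracket g x w \<oplus> bracket g y w"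
    and bracket_smult_left:
      "\<lbrakk>x \<in> carrier g; y \<in> carrier g\<rbrakk>
        \<Longrightarrow> bracket g (c \<odot> x) y = c \<odot> bracket g x y"
    and bracket_add_right:
      "\<lbrakk>x \<in> carrier g; y \<in> carrier g; w \<in> carrier g\<rbrakk>
        \<Longrightarrow> bracket g x (y \<oplus> w) = bracket g x y \<oplus> bracket g x w"
    and bracket_smult_right:
      "\<lbrakk>x \<in> carrier g; y \<in> carrier g\<rbrakk>
        \<Longrightarrow> bracket g x (c \<odot> y) = c \<odot> bracket g x y"
    and bracket_self: "x \<in> carrier g \<Longrightarrow> bracket g x x = \<zero>"
    and jacobi:
      "\<lbrakk>x \<in> carrier g; y \<in> carrier g; w \<in> carrier g\<rbrakk>
        \<Longrightarrow> bracket g x (bracket g y w) \<oplus> bracket g y (bracket g w x)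
              \<oplus> bracket g w (bracket g x y) = \<zero>"

locale two_step_nilpotent = real_lie_algebra +
  assumes two_step:
    "\<lbrakk>x \<in> carrier g; y \<in> carrier g; w \<in> carrier g\<rbrakk>
      \<Longrightarrow> bracket g x (bracket g y w) = \<zero>"

definition derived_algebra :: "(real, 'b, 'm) lie_scheme \<Rightarrow> 'b set" where
  "derived_algebra g =
     LinearCombinations.module.span class_ring g
       {bracket g x y |x y. x \<in> carrier g \<and> y \<in> carrier g}"

text \<open>Cosets are added as sets; scalar multiplication and the bracket are computed on
  representatives, in the style of \<open>rcoset_mult\<close>. The ring fields \<open>mult\<close> and \<open>one\<close>
  of the \<open>module\<close> record play no role.\<close>

definition quotient_space ::
    "(real, 'b, 'm) module_scheme \<Rightarrow> 'b set \<Rightarrow> (real, 'b set) module" where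
  "quotient_space V W =
    \<lparr>carrier = a_rcosets\<^bsub>V\<^esub> W,
     mult = undefined, one = undefined,
     zero = W,
     add = set_add V,
     smult = (\<lambda>c C. \<Union>x\<in>C. W +>\<^bsub>V\<^esub> (c \<odot>\<^bsub>V\<^esub> x))\<rparr>"

definition quotient_lie ::
    "(real, 'b, 'm) lie_scheme \<Rightarrow> 'b set \<Rightarrow> (real, 'b set) lie" where
  "quotient_lie g W =
    \<lparr>carrier = a_rcosets\<^bsub>g\<^esub> W,
     mult = undefined, one = undefined,
     zero = W,
     add = set_add g,
     smult = (\<lambda>c C. \<Union>x\<in>C. W +>\<^bsub>g\<^esub> (c \<odot>\<^bsub>g\<^esub> x)),
     bracket = (\<lambda>C D. \<Union>x\<in>C. \<Union>y\<in>D. W +>\<^bsub>g\<^esub> bracket g x y)\<rparr>"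

text \<open>The exterior power of degree \<open>k\<close> of the dual is realised as the space of alternating
  \<open>k\<close>-linear forms, a form being a function on argument lists. To make equality of forms
  extensional, forms vanish on lists of the wrong length or with entries outside the
  carrier.\<close>

definition alt_forms :: "(real, 'b, 'm) module_scheme \<Rightarrow> nat \<Rightarrow> ('b list \<Rightarrow> real) set" where
  "alt_forms V k = {\<omega>.
     (\<forall>xs. \<not> (length xs = k \<and> set xs \<subseteq> carrier V) \<longrightarrow> \<omega> xs = 0) \<and>
     (\<forall>xs i x y. length xs = k \<and> set xs \<subseteq> carrier V \<and> i < k \<and> x \<in> carrier V \<and> y \<in> carrier V
        \<longrightarrow> \<omega> (xs[i := x \<oplus>\<^bsub>V\<^esub> y]) = \<omega> (xs[i := x]) + \<omega> (xs[i := y])) \<and>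
     (\<forall>xs i c x. length xs = k \<and> set xs \<subseteq> carrier V \<and> i < k \<and> x \<in> carrier V
        \<longrightarrow> \<omega> (xs[i := c \<odot>\<^bsub>V\<^esub> x]) = c * \<omega> (xs[i := x])) \<and>
     (\<forall>xs i j. length xs = k \<and> set xs \<subseteq> carrier V \<and> i < j \<and> j < k \<and> xs ! i = xs ! j
        \<longrightarrow> \<omega> xs = 0)}"

definition cochains ::
    "(real, 'b, 'm) module_scheme \<Rightarrow> nat \<Rightarrow> (real, 'b list \<Rightarrow> real) module" where
  "cochains V k =
    \<lparr>carrier = alt_forms V k,
     mult = undefined, one = undefined,
     zero = (\<lambda>xs. 0),
     add = (\<lambda>\<alpha> \<beta> xs. \<alpha> xs + \<beta> xs),
     smult = (\<lambda>c \<alpha> xs. c * \<alpha> xs)\<rparr>"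

text \<open>The exterior product as a sum over shuffles: \<open>S\<close> is the set of argument positions
  passed to \<open>\<alpha>\<close>, and the sign is that of the permutation moving these positions to the
  front. If \<open>\<alpha>\<close> has degree \<open>k\<close> then only the sets \<open>S\<close> with \<open>k\<close> elements contribute. For
  one-forms this gives \<open>\<alpha>(x) \<beta>(y) - \<alpha>(y) \<beta>(x)\<close>.\<close>

definition wedge :: "('b list \<Rightarrow> real) \<Rightarrow> ('b list \<Rightarrow> real) \<Rightarrow> 'b list \<Rightarrow> real" where
  "wedge \<alpha> \<beta> = (\<lambda>xs. \<Sum>S\<in>Pow {..<length xs}.
     (-1) ^ card {(i, j). i \<in> S \<and> j \<in> {..<length xs} - S \<and> j < i}
       * \<alpha> (nths xs S) * \<beta> (nths xs (- S)))"

text \<open>On a finite-dimensional Lie algebra the one-forms generate the exterior algebra, so there is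
  at most one such derivation. Since HOL functions are total, its value outside the exterior
  algebra is fixed by extensionality.\<close>

definition is_CE_differential ::
    "(real, 'b, 'm) lie_scheme \<Rightarrow> (('b list \<Rightarrow> real) \<Rightarrow> ('b list \<Rightarrow> real)) \<Rightarrow> bool" where
  "is_CE_differential g D \<longleftrightarrow>
     D \<in> extensional (\<Union>k. alt_forms g k) \<and>
     (\<forall>k. linear_map class_ring (cochains g k) (cochains g (Suc k)) D) \<and>
     (\<forall>k l. \<forall>\<alpha>\<in>alt_forms g k. \<forall>\<beta>\<in>alt_forms g l.
        D (wedge \<alpha> \<beta>) = (\<lambda>xs. wedge (D \<alpha>) \<beta> xs + (-1) ^ k * wedge \<alpha> (D \<beta>) xs)) \<and>
     (\<forall>\<phi>\<in>alt_forms g 1. \<forall>x\<in>carrier g. \<forall>y\<in>carrier g. D \<phi> [x, y] = \<phi> [bracket g x y])"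

definition CE_differential ::
    "(real, 'b, 'm) lie_scheme \<Rightarrow> ('b list \<Rightarrow> real) \<Rightarrow> ('b list \<Rightarrow> real)" where
  "CE_differential g = (THE D. is_CE_differential g D)"

definition cocycles :: "(real, 'b, 'm) lie_scheme \<Rightarrow> nat \<Rightarrow> ('b list \<Rightarrow> real) set" where
  "cocycles g k = {\<omega> \<in> alt_forms g k. CE_differential g \<omega> = (\<lambda>xs. 0)}"

fun coboundaries :: "(real, 'b, 'm) lie_scheme \<Rightarrow> nat \<Rightarrow> ('b list \<Rightarrow> real) set" where
  "coboundaries g 0 = {\<lambda>xs. 0}"
| "coboundaries g (Suc k) = CE_differential g ` alt_forms g k"

definition cohomology ::
    "(real, 'b, 'm) lie_scheme \<Rightarrow> nat \<Rightarrow> (real, ('b list \<Rightarrow> real) set) module" where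
  "cohomology g k =
     quotient_space (cochains g k\<lparr>carrier := cocycles g k\<rparr>) (coboundaries g k)"

definition pullback ::
    "(real, 'b, 'm) module_scheme \<Rightarrow> ('b \<Rightarrow> 'c) \<Rightarrow> ('c list \<Rightarrow> real) \<Rightarrow> 'b list \<Rightarrow> real" where
  "pullback V f \<omega> = (\<lambda>xs. if set xs \<subseteq> carrier V then \<omega> (map f xs) else 0)"

definition cohomology_map ::
    "(real, 'b, 'm) lie_scheme \<Rightarrow> nat \<Rightarrow> ('b \<Rightarrow> 'c)
      \<Rightarrow> ('c list \<Rightarrow> real) set \<Rightarrow> ('b list \<Rightarrow> real) set" where
  "cohomology_map g k f C =
     (\<Union>\<omega>\<in>C. coboundaries g k +>\<^bsub>cochains g k\<^esub> pullback g f \<omega>)"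

definition abelianization :: "(real, 'b, 'm) lie_scheme \<Rightarrow> (real, 'b set) lie" where
  "abelianization g = quotient_lie g (derived_algebra g)"

definition abelianization_map :: "(real, 'b, 'm) lie_scheme \<Rightarrow> 'b \<Rightarrow> 'b set" where
  "abelianization_map g x = derived_algebra g +>\<^bsub>g\<^esub> x"

definition basic_cohomology ::
    "(real, 'b, 'm) lie_scheme \<Rightarrow> nat \<Rightarrow> ('b list \<Rightarrow> real) set set" where
  "basic_cohomology g k =
     cohomology_map g k (abelianization_map g) ` carrier (cohomology (abelianization g) k)"

definition basic_betti :: "(real, 'b, 'm) lie_scheme \<Rightarrow> nat \<Rightarrow> nat" where
  "basic_betti g k =
     vectorspace.dim (class_ring :: real ring)
       (cohomology g k\<lparr>carrier := basic_cohomology g k\<rparr>)"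

definition independence_number :: "(real, 'b, 'm) lie_scheme \<Rightarrow> nat" where
  "independence_number g = (GREATEST k. basic_betti g k \<noteq> 0)"

definition independence_poly :: "(real, 'b, 'm) lie_scheme \<Rightarrow> int poly" where
  "independence_poly g = (\<Sum>k\<le>independence_number g. monom (int (basic_betti g k)) k)"

text \<open>Indices start at \<open>0\<close>: the unit vectors \<open>0, \<dots>, 2n - 1\<close> are the basis elements
  \<open>y\<^sub>1, \<dots>, y\<^sub>2\<^sub>n\<close>, and the last unit vector is \<open>z\<close>.\<close>

definition heisenberg :: "nat \<Rightarrow> (real, real vec) lie" where
  "heisenberg n =
    \<lparr>carrier = carrier_vec (2 * n + 1),
     mult = undefined, one = undefined,
     zero = 0\<^sub>v (2 * n + 1),
     add = (+),
     smult = (\<cdot>\<^sub>v),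
     bracket = (\<lambda>v w. (\<Sum>k<n. v $ (2 * k) * w $ (2 * k + 1) - v $ (2 * k + 1) * w $ (2 * k))
                        \<cdot>\<^sub>v unit_vec (2 * n + 1) (2 * n))\<rparr>"

definition heis_y :: "nat \<Rightarrow> nat \<Rightarrow> real vec" where
  "heis_y n i = unit_vec (2 * n + 1) (i - 1)"

definition heis_z :: "nat \<Rightarrow> real vec" where
  "heis_z n = unit_vec (2 * n + 1) (2 * n)"

lemma heisenberg_simps [simp]:
  "carrier (heisenberg n) = carrier_vec (2 * n + 1)"
  "zero (heisenberg n) = 0\<^sub>v (2 * n + 1)"
  "add (heisenberg n) = (+)"
  "module.smult (heisenberg n) = (\<cdot>\<^sub>v)"
  "bracket (heisenberg n) v w =
     (\<Sum>k<n. v $ (2 * k) * w $ (2 * k + 1) - v $ (2 * k + 1) * w $ (2 * k))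
       \<cdot>\<^sub>v unit_vec (2 * n + 1) (2 * n)"
  by (simp_all add: heisenberg_def)

lemma heisenberg_vectorspace: "vectorspace class_ring (heisenberg n)"
proof -
  show ?thesis
  proof (intro vectorspace.intro Module.module.intro abelian_groupI Module.module_axioms.intro)
    fix x assume x: "x \<in> carrier (heisenberg n)"
    then show "\<exists>y\<in>carrier (heisenberg n). y \<oplus>\<^bsub>heisenberg n\<^esub> x = \<zero>\<^bsub>heisenberg n\<^esub>"
      by (intro bexI[of _ "- x"]) auto
  qed (auto simp: class_ring_simps add_smult_distrib_vec smult_add_distrib_vec
         smult_smult_assoc class_field class_field [THEN fieldE(1)]
         intro: add_carrier_vec comm_add_vec assoc_add_vec)
qed

lemma heisenberg_two_step_nilpotent: "two_step_nilpotent (heisenberg n)"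
proof -
  interpret vectorspace class_ring "heisenberg n"
    by (rule heisenberg_vectorspace)
  have *: "(\<Sum>k<n. v $ (2 * k) * (a \<cdot>\<^sub>v unit_vec (2 * n + 1) (2 * n)) $ (2 * k + 1)
             - v $ (2 * k + 1) * (a \<cdot>\<^sub>v unit_vec (2 * n + 1) (2 * n)) $ (2 * k)) = 0"
    for v and a :: real
    by (intro sum.neutral) auto
  have add: "(\<Sum>k<n. (x + y) $ (2 * k) * w $ (2 * k + 1) - (x + y) $ (2 * k + 1) * w $ (2 * k))
      = (\<Sum>k<n. x $ (2 * k) * w $ (2 * k + 1) - x $ (2 * k + 1) * w $ (2 * k))
        + (\<Sum>k<n. y $ (2 * k) * w $ (2 * k + 1) - y $ (2 * k + 1) * w $ (2 * k))"
    "(\<Sum>k<n. w $ (2 * k) * (x + y) $ (2 * k + 1) - w $ (2 * k + 1) * (x + y) $ (2 * k))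
      = (\<Sum>k<n. w $ (2 * k) * x $ (2 * k + 1) - w $ (2 * k + 1) * x $ (2 * k))
        + (\<Sum>k<n. w $ (2 * k) * y $ (2 * k + 1) - w $ (2 * k + 1) * y $ (2 * k))"
    if "x \<in> carrier_vec (2 * n + 1)" "y \<in> carrier_vec (2 * n + 1)" for x y w :: "real vec"
    using that by (auto simp: sum.distrib [symmetric] algebra_simps intro!: sum.cong)
  have smult: "(\<Sum>k<n. (c \<cdot>\<^sub>v x) $ (2 * k) * w $ (2 * k + 1) - (c \<cdot>\<^sub>v x) $ (2 * k + 1) * w $ (2 * k))
      = c * (\<Sum>k<n. x $ (2 * k) * w $ (2 * k + 1) - x $ (2 * k + 1) * w $ (2 * k))"
    "(\<Sum>k<n. w $ (2 * k) * (c \<cdot>\<^sub>v x) $ (2 * k + 1) - w $ (2 * k + 1) * (c \<cdot>\<^sub>v x) $ (2 * k))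
      = c * (\<Sum>k<n. w $ (2 * k) * x $ (2 * k + 1) - w $ (2 * k + 1) * x $ (2 * k))"
    if "x \<in> carrier_vec (2 * n + 1)" for c and x w :: "real vec"
    using that by (auto simp: sum_distrib_left algebra_simps intro!: sum.cong)
  have zero: "0 \<cdot>\<^sub>v unit_vec (2 * n + 1) (2 * n) = (0\<^sub>v (2 * n + 1) :: real vec)"
    by (rule eq_vecI) auto
  show ?thesis
  proof unfold_locales
    fix x y w assume "x \<in> carrier (heisenberg n)" "y \<in> carrier (heisenberg n)" "w \<in> carrier (heisenberg n)"
    then show "bracket (heisenberg n) x (bracket (heisenberg n) y w) = \<zero>\<^bsub>heisenberg n\<^esub>"
      "bracket (heisenberg n) x (bracket (heisenberg n) y w) \<oplus>\<^bsub>heisenberg n\<^esub>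
       bracket (heisenberg n) y (bracket (heisenberg n) w x) \<oplus>\<^bsub>heisenberg n\<^esub>
       bracket (heisenberg n) w (bracket (heisenberg n) x y) = \<zero>\<^bsub>heisenberg n\<^esub>"
      unfolding heisenberg_simps * zero by simp_all
  qed (simp_all only: heisenberg_simps add smult, auto simp: add_smult_distrib_vec smult_smult_assoc)
qed

lemma heis_basis_eq: "insert (heis_z n) (heis_y n ` {1..2 * n}) = set (unit_vecs (2 * n + 1))"
proof -
  have "heis_y n ` {1..2 * n} = unit_vec (2 * n + 1) ` {0..<2 * n}"
    by (force simp: heis_y_def image_iff intro: bexI[of _ "Suc _"])
  then show ?thesis
    by (auto simp: unit_vecs_def heis_z_def less_Suc_eq)
qed

lemma heisenberg_basis:
  "vectorspace.basis class_ring (heisenberg n) (insert (heis_z n) (heis_y n ` {1..2 * n}))"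
  "card (insert (heis_z n) (heis_y n ` {1..2 * n})) = 2 * n + 1"
proof -
  let ?V = "module_vec TYPE(real) (2 * n + 1)"
  interpret H: vectorspace class_ring "heisenberg n" by (rule heisenberg_vectorspace)
  interpret V: vec_space "TYPE(real)" "2 * n + 1" .
  have "finsum (heisenberg n) f A = finsum ?V f A" for f :: "real vec \<Rightarrow> real vec" and A
    by (simp add: finsum_def finprod_def module_vec_simps)
  then have "H.lincomb = V.lincomb"
    by (intro ext) (simp add: H.lincomb_def LinearCombinations.module.lincomb_def [OF vec_module] module_vec_simps)
  then have "H.basis S = V.basis S" for S
    by (simp add: H.basis_def vectorspace.basis_def [OF vec_vs] H.lin_dep_def H.span_def
      LinearCombinations.module.lin_dep_def [OF vec_module]
      LinearCombinations.module.span_def [OF vec_module] module_vec_simps)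
  then show "H.basis (insert (heis_z n) (heis_y n ` {1..2 * n}))"
    unfolding heis_basis_eq using V.unit_vecs_basis by simp
  show "card (insert (heis_z n) (heis_y n ` {1..2 * n})) = 2 * n + 1"
    unfolding heis_basis_eq using distinct_card [OF V.unit_vecs_distinct] by (simp add: unit_vecs_def)
qed

lemma heisenberg_bracket_basis:
  assumes "k \<in> {1..n}"
  shows "bracket (heisenberg n) (heis_y n (2 * k - 1)) (heis_y n (2 * k)) = heis_z n"
proof -
  have "(\<Sum>l<n. heis_y n (2 * k - 1) $ (2 * l) * heis_y n (2 * k) $ (2 * l + 1)
          - heis_y n (2 * k - 1) $ (2 * l + 1) * heis_y n (2 * k) $ (2 * l))
        = (\<Sum>l<n. if l = k - 1 then 1 else 0)"
    using assms by (intro sum.cong refl) (auto simp: heis_y_def unit_vec_def; presburger)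
  also have "\<dots> = 1"
    using assms by (auto simp: Suc_le_eq)
  finally show ?thesis
    by (simp only: heisenberg_simps heis_z_def) simp
qed

lemma heisenberg_bracket_other:
  assumes "i \<in> {1..2 * n}" "j \<in> {1..2 * n}" "i < j"
    and "\<not> (\<exists>k\<in>{1..n}. i = 2 * k - 1 \<and> j = 2 * k)"
  shows "bracket (heisenberg n) (heis_y n i) (heis_y n j) = 0\<^sub>v (2 * n + 1)"
proof -
  have "heis_y n i $ (2 * l) * heis_y n j $ (2 * l + 1)
          - heis_y n i $ (2 * l + 1) * heis_y n j $ (2 * l) = 0" if "l < n" for l
    using assms that bspec[of "{1..n}" "\<lambda>k. \<not> (i = 2 * k - 1 \<and> j = 2 * k)" "l + 1"]
    by (auto simp: heis_y_def unit_vec_def)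
  then show ?thesis
    by (simp only: heisenberg_simps) (auto simp: sum.neutral intro!: eq_vecI)
qed

lemma heisenberg_bracket_z:
  assumes "x \<in> carrier (heisenberg n)"
  shows "bracket (heisenberg n) x (heis_z n) = 0\<^sub>v (2 * n + 1)"
proof -
  have "x $ (2 * l) * heis_z n $ (2 * l + 1) - x $ (2 * l + 1) * heis_z n $ (2 * l) = 0"
    if "l < n" for l
    using that by (auto simp: heis_z_def)
  then show ?thesis
    by (simp only: heisenberg_simps) (auto simp: sum.neutral intro!: eq_vecI)
qed

definition binom :: "nat \<Rightarrow> int \<Rightarrow> int" where
  "binom a j = (if j < 0 then 0 else int (a choose nat j))"

end

theory Submission
  imports Defs
begin

text \<open>
  Let \<open>\<Omega> = y\<^sub>1\<^sup>* \<and> y\<^sub>2\<^sup>* + \<dots> + y\<^sub>2\<^sub>n\<^sub>-\<^sub>1\<^sup>* \<and> y\<^sub>2\<^sub>n\<^sup>*\<close>, so that the bracket is \<open>[x, y] = \<Omega>(x, y) z\<close>. Contraction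
  with \<open>z\<close> followed by multiplication by \<open>\<Omega>\<close> is a derivation with the right values on one-forms, and it
  is the only one: the differential of the Heisenberg algebra is \<open>\<omega> \<mapsto> \<Omega> \<and> \<iota>\<^sub>z \<omega>\<close>
  (\<open>heis_CE_differential\<close>). The forms pulled back from the abelianization, on which the differential
  is zero, are the horizontal ones, those killed by \<open>\<iota>\<^sub>z\<close> (\<open>pullback_image\<close>); in degree \<open>k\<close> they form a
  space of dimension \<open>2n choose k\<close> (\<open>horizontal_dim\<close>). Since \<open>\<iota>\<^sub>z\<close> maps all forms onto the horizontal
  ones, the coboundaries of degree \<open>k\<close> are exactly the products of \<open>\<Omega>\<close> with horizontal forms of degree
  \<open>k - 2\<close> (\<open>heis_coboundaries\<close>). Basic cohomology in degree \<open>k\<close> is therefore the cokernel of the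
  Lefschetz operator \<open>L = \<Omega> \<and> \<dots>\<close> from horizontal forms of degree \<open>k - 2\<close> to those of degree \<open>k\<close>.

  The theorem thus reduces to the linear part of the hard Lefschetz theorem. With the dual operator \<open>\<Lambda>\<close>
  one has \<open>\<Lambda> L - L \<Lambda> = n - k\<close> on horizontal \<open>k\<close>-forms (\<open>lefschetz_commutator\<close>), which forces \<open>L\<close> to be
  injective in degrees below \<open>n\<close> (\<open>lefschetz_injective\<close>). So the Betti number in degree \<open>k \<le> n + 1\<close> is the
  difference of binomial coefficients (\<open>heis_basic_betti_low\<close>). It is positive for \<open>k = n\<close> and zero for
  \<open>k = n + 1\<close>; and once all horizontal forms of degree \<open>n + 1\<close> are multiples of \<open>\<Omega>\<close>, so are those of
  higher degree (\<open>heis_basic_betti_high\<close>). Hence the independence number is \<open>n\<close>.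

  Two devices keep the exterior algebra manageable. A \<open>k\<close>-form is a function on lists, and the exterior
  product satisfies a recursion on the argument list (\<open>wedge_Cons\<close>) from which associativity, graded
  commutativity and the antiderivation property of contractions follow by induction. And the Euler
  identity \<open>\<Sum>\<^sub>i \<phi>\<^sub>i \<and> \<iota>\<^sub>e\<^sub>i \<omega> = k \<omega>\<close> (\<open>euler_identity\<close>) replaces bases of the exterior powers wherever forms
  have to be decomposed into products.
\<close>

section \<open>The exterior product as a signed shuffle product of functions on lists\<close>

definition contract :: "'b \<Rightarrow> ('b list \<Rightarrow> real) \<Rightarrow> 'b list \<Rightarrow> real" where
  "contract x \<alpha> = (\<lambda>xs. \<alpha> (x # xs))"

text \<open>The grading involution. Carrying this sign as an operator on functions, instead of a degree
  \<open>k\<close>, makes the recursion below hold for arbitrary functions on lists.\<close>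

definition twist :: "('b list \<Rightarrow> real) \<Rightarrow> 'b list \<Rightarrow> real" where
  "twist \<alpha> = (\<lambda>xs. (-1) ^ length xs * \<alpha> xs)"

definition unit_form :: "'b list \<Rightarrow> real" where
  "unit_form = (\<lambda>xs. if xs = [] then 1 else 0)"

lemma wedge_Nil [simp]: "wedge \<alpha> \<beta> [] = \<alpha> [] * \<beta> []"
  by (simp add: wedge_def)

text \<open>The two lemmas on inversions compare the sign of a shuffle of \<open>x # xs\<close> with that of the shuffle
  of \<open>xs\<close> it induces: the new position \<open>0\<close> creates one inversion for each chosen position if it is
  not chosen itself, and none if it is.\<close>

lemma shuffle_inversions_Suc:
  assumes "S \<subseteq> {..<n}"
  shows "{(i, j). i \<in> Suc ` S \<and> j \<in> {..<Suc n} - Suc ` S \<and> j < i}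
      = (\<lambda>i. (Suc i, 0)) ` S \<union> map_prod Suc Suc ` {(i, j). i \<in> S \<and> j \<in> {..<n} - S \<and> j < i}"
    (is "?A = ?B")
proof (intro equalityI subsetI)
  fix p assume "p \<in> ?A"
  then obtain i j where p: "p = (Suc i, j)" "i \<in> S" "j < Suc n" "j \<notin> Suc ` S" "j < Suc i"
    by auto
  then show "p \<in> ?B"
    by (cases j) (force simp: image_iff)+
qed (use assms in auto)

lemma shuffle_inversions_insert:
  "{(i, j). i \<in> insert 0 (Suc ` S) \<and> j \<in> {..<Suc n} - insert 0 (Suc ` S) \<and> j < i}
      = map_prod Suc Suc ` {(i, j). i \<in> S \<and> j \<in> {..<n} - S \<and> j < i}" (is "?A = ?B")
proof (intro equalityI subsetI)
  fix p assume "p \<in> ?A"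
  then obtain i j where p: "p = (Suc i, j)" "i \<in> S" "j < Suc n" "j \<notin> insert 0 (Suc ` S)" "j < Suc i"
    by auto
  then show "p \<in> ?B"
    by (cases j) (force simp: image_iff)+
qed auto

text \<open>The workhorse: the first argument is fed to one of the two factors, which turns the sum over
  shuffles into a recursion on the argument list. It says that an interior product is an
  antiderivation, and all algebraic laws of the exterior product follow from it by induction on the
  argument list, without any further permutation of shuffles.\<close>

lemma wedge_Cons:
  "wedge \<alpha> \<beta> (x # xs) = wedge (contract x \<alpha>) \<beta> xs + wedge (twist \<alpha>) (contract x \<beta>) xs"
proof -
  let ?n = "length xs"
  let ?inv = "\<lambda>n S. {(i, j). i \<in> S \<and> j \<in> {..<n} - S \<and> j < i}"
  let ?term = "\<lambda>S. (-1) ^ card (?inv (Suc ?n) S) * \<alpha> (nths (x # xs) S) * \<beta> (nths (x # xs) (- S))"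
  have Pow: "Pow {..<Suc ?n} = image Suc ` Pow {..<?n} \<union> (\<lambda>S. insert 0 (Suc ` S)) ` Pow {..<?n}"
    by (simp add: lessThan_Suc_eq_insert_0 Pow_insert image_Pow_surj [OF refl, symmetric] image_image)
  have inj: "inj_on (image Suc) (Pow {..<?n})" "inj_on (\<lambda>S. insert 0 (Suc ` S)) (Pow {..<?n})"
    by (auto intro!: inj_onI)
  have nths: "nths (x # xs) (Suc ` S) = nths xs S" "nths (x # xs) (- Suc ` S) = x # nths xs (- S)"
    "nths (x # xs) (insert 0 (Suc ` S)) = x # nths xs S"
    "nths (x # xs) (- insert 0 (Suc ` S)) = nths xs (- S)" for S
    by (auto simp: nths_Cons intro!: arg_cong [of _ _ "nths xs"])
  have out: "?term (Suc ` S) = (-1) ^ card (?inv ?n S) * twist \<alpha> (nths xs S) * contract x \<beta> (nths xs (- S))"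
    if S: "S \<subseteq> {..<?n}" for S
  proof -
    have fin: "finite S" "finite (?inv ?n S)"
      using S by (auto intro: finite_subset [of _ "{..<?n}"] finite_subset [of _ "{..<?n} \<times> {..<?n}"])
    have "card (?inv (Suc ?n) (Suc ` S)) = card S + card (?inv ?n S)"
      unfolding shuffle_inversions_Suc [OF S] using fin
      by (subst card_Un_disjoint) (auto simp: card_image inj_on_def)
    moreover have "length (nths xs S) = card S"
      using S by (auto simp: length_nths intro!: arg_cong [of _ _ card])
    ultimately show ?thesis
      by (simp add: nths twist_def contract_def power_add)
  qed
  have into: "?term (insert 0 (Suc ` S)) = (-1) ^ card (?inv ?n S) * contract x \<alpha> (nths xs S) * \<beta> (nths xs (- S))"
    for S
    unfolding shuffle_inversions_insert by (simp add: nths contract_def card_image inj_on_def map_prod_def)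
  have "wedge \<alpha> \<beta> (x # xs) = sum ?term (Pow {..<Suc ?n})"
    by (simp add: wedge_def)
  also have "\<dots> = sum ?term (image Suc ` Pow {..<?n}) + sum ?term ((\<lambda>S. insert 0 (Suc ` S)) ` Pow {..<?n})"
    unfolding Pow by (rule sum.union_disjoint) auto
  also have "\<dots> = wedge (twist \<alpha>) (contract x \<beta>) xs + wedge (contract x \<alpha>) \<beta> xs"
    unfolding wedge_def sum.reindex [OF inj(1)] sum.reindex [OF inj(2)] comp_def
    using out into by (intro arg_cong2 [of _ _ _ _ "(+)"] sum.cong) (auto simp del: insert_iff)
  finally show ?thesis
    by simp
qed

lemma contract_wedge:
  "contract x (wedge \<alpha> \<beta>) = (\<lambda>xs. wedge (contract x \<alpha>) \<beta> xs + wedge (twist \<alpha>) (contract x \<beta>) xs)"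
  by (rule ext) (simp add: contract_def [of x "wedge \<alpha> \<beta>"] wedge_Cons)

lemma wedge_add_left: "wedge (\<lambda>xs. \<alpha> xs + \<beta> xs) \<gamma> = (\<lambda>xs. wedge \<alpha> \<gamma> xs + wedge \<beta> \<gamma> xs)"
  by (simp add: wedge_def algebra_simps sum.distrib)

lemma wedge_add_right: "wedge \<alpha> (\<lambda>xs. \<beta> xs + \<gamma> xs) = (\<lambda>xs. wedge \<alpha> \<beta> xs + wedge \<alpha> \<gamma> xs)"
  by (simp add: wedge_def algebra_simps sum.distrib)

lemma wedge_scale_left: "wedge (\<lambda>xs. c * \<alpha> xs) \<beta> = (\<lambda>xs. c * wedge \<alpha> \<beta> xs)"
  by (simp add: wedge_def algebra_simps sum_distrib_left)

lemma wedge_scale_right: "wedge \<alpha> (\<lambda>xs. c * \<beta> xs) = (\<lambda>xs. c * wedge \<alpha> \<beta> xs)"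
  by (simp add: wedge_def algebra_simps sum_distrib_left)

lemma wedge_uminus_left: "wedge (\<lambda>xs. - \<alpha> xs) \<beta> = (\<lambda>xs. - wedge \<alpha> \<beta> xs)"
  using wedge_scale_left [of "-1"] by simp

lemma wedge_uminus_right: "wedge \<alpha> (\<lambda>xs. - \<beta> xs) = (\<lambda>xs. - wedge \<alpha> \<beta> xs)"
  using wedge_scale_right [of _ "-1"] by simp

lemma wedge_zero_left [simp]: "wedge (\<lambda>xs. 0) \<beta> = (\<lambda>xs. 0)"
  by (simp add: wedge_def)

lemma wedge_zero_right [simp]: "wedge \<alpha> (\<lambda>xs. 0) = (\<lambda>xs. 0)"
  by (simp add: wedge_def)

lemma wedge_sum_right: "wedge \<alpha> (\<lambda>xs. \<Sum>i\<in>I. \<beta> i xs) = (\<lambda>xs. \<Sum>i\<in>I. wedge \<alpha> (\<beta> i) xs)"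
  by (induction I rule: infinite_finite_induct) (simp_all add: wedge_add_right)

lemma contract_simps:
  "contract x (\<lambda>xs. 0) = (\<lambda>xs. 0)"
  "contract x (\<lambda>xs. \<alpha> xs + \<beta> xs) = (\<lambda>xs. contract x \<alpha> xs + contract x \<beta> xs)"
  "contract x (\<lambda>xs. - \<alpha> xs) = (\<lambda>xs. - contract x \<alpha> xs)"
  "contract x (\<lambda>xs. c * \<alpha> xs) = (\<lambda>xs. c * contract x \<alpha> xs)"
  "contract x (\<lambda>xs. \<Sum>i\<in>I. \<gamma> i xs) = (\<lambda>xs. \<Sum>i\<in>I. contract x (\<gamma> i) xs)"
  by (simp_all add: contract_def)

lemma contract_twist: "contract x (twist \<alpha>) = (\<lambda>xs. - twist (contract x \<alpha>) xs)"
  by (simp add: contract_def twist_def fun_eq_iff)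

lemma twist_twist [simp]: "twist (twist \<alpha>) = \<alpha>"
  by (simp add: twist_def fun_eq_iff flip: power_add)

lemma twist_add: "twist (\<lambda>xs. \<alpha> xs + \<beta> xs) = (\<lambda>xs. twist \<alpha> xs + twist \<beta> xs)"
  by (simp add: twist_def algebra_simps)

lemma twist_wedge: "twist (wedge \<alpha> \<beta>) = wedge (twist \<alpha>) (twist \<beta>)"
proof
  show "twist (wedge \<alpha> \<beta>) xs = wedge (twist \<alpha>) (twist \<beta>) xs" for xs
  proof (induction xs arbitrary: \<alpha> \<beta>)
    case Nil
    then show ?case by (simp add: twist_def)
  next
    case (Cons x xs)
    have "twist (wedge \<alpha> \<beta>) (x # xs) = - twist (contract x (wedge \<alpha> \<beta>)) xs"
      using fun_cong [OF contract_twist, of x "wedge \<alpha> \<beta>" xs] by (simp add: contract_def)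
    then show ?case
      by (simp add: contract_wedge wedge_Cons contract_twist twist_add Cons wedge_uminus_left wedge_uminus_right)
  qed
qed

lemma wedge_assoc: "wedge (wedge \<alpha> \<beta>) \<gamma> = wedge \<alpha> (wedge \<beta> \<gamma>)"
proof
  show "wedge (wedge \<alpha> \<beta>) \<gamma> xs = wedge \<alpha> (wedge \<beta> \<gamma>) xs" for xs
    by (induction xs arbitrary: \<alpha> \<beta> \<gamma>)
       (simp_all add: wedge_Cons contract_wedge twist_wedge wedge_add_left wedge_add_right)
qed

lemma twist_unit_form [simp]: "twist unit_form = unit_form"
  and contract_unit_form [simp]: "contract x unit_form = (\<lambda>xs. 0)"
  by (auto simp: twist_def unit_form_def contract_def)

lemma wedge_unit_left [simp]: "wedge unit_form \<alpha> = \<alpha>"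
proof
  show "wedge unit_form \<alpha> xs = \<alpha> xs" for xs
    by (induction xs arbitrary: \<alpha>) (simp add: unit_form_def, simp add: wedge_Cons, simp add: contract_def)
qed

lemma wedge_unit_right [simp]: "wedge \<alpha> unit_form = \<alpha>"
proof
  show "wedge \<alpha> unit_form xs = \<alpha> xs" for xs
    by (induction xs arbitrary: \<alpha>) (simp add: unit_form_def, simp add: wedge_Cons, simp add: contract_def)
qed

text \<open>Graded commutativity depends on the parities of the two factors only, so it is stated for eigenvectors
  of the grading involution; an interior product changes the parity, which is how the induction
  runs.\<close>

lemma wedge_commute_parity:
  assumes "twist \<alpha> = (\<lambda>xs. (-1) ^ k * \<alpha> xs)" "twist \<beta> = (\<lambda>xs. (-1) ^ l * \<beta> xs)"
  shows "wedge \<alpha> \<beta> = (\<lambda>xs. (-1) ^ (k * l) * wedge \<beta> \<alpha> xs)"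
proof
  show "wedge \<alpha> \<beta> xs = (-1) ^ (k * l) * wedge \<beta> \<alpha> xs" for xs
    using assms
  proof (induction xs arbitrary: \<alpha> \<beta> k l)
    case Nil
    have "even k" if "\<alpha> [] \<noteq> 0"
      using fun_cong [OF Nil(1), of "[]"] that by (cases "even k") (auto simp: twist_def)
    then show ?case by auto
  next
    case (Cons x xs)
    have step: "twist (contract x \<gamma>) = (\<lambda>xs. (-1) ^ Suc m * contract x \<gamma> xs)"
      if "twist \<gamma> = (\<lambda>xs. (-1) ^ m * \<gamma> xs)" for \<gamma> m
      using contract_twist [of x \<gamma>] unfolding that contract_simps by (simp add: fun_eq_iff)
    have "wedge (contract x \<alpha>) \<beta> xs = (-1) ^ (Suc k * l) * wedge \<beta> (contract x \<alpha>) xs"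
      by (rule Cons.IH [OF step Cons.prems(2)]) (rule Cons.prems)
    moreover have "wedge \<alpha> (contract x \<beta>) xs = (-1) ^ (k * Suc l) * wedge (contract x \<beta>) \<alpha> xs"
      by (rule Cons.IH [OF Cons.prems(1) step]) (rule Cons.prems)
    ultimately show ?case
      by (cases "even k"; cases "even l") (simp_all add: wedge_Cons Cons.prems wedge_uminus_left)
  qed
qed

section \<open>Alternating forms\<close>

lemma alt_forms_zero_form [simp]: "(\<lambda>xs. 0) \<in> alt_forms V k"
  by (simp add: alt_forms_def)

lemma alt_forms_support:
  assumes "\<omega> \<in> alt_forms V k" "length xs \<noteq> k \<or> \<not> set xs \<subseteq> carrier V"
  shows "\<omega> xs = 0"
  using assms by (auto simp: alt_forms_def)

lemma alt_forms_eqI: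
  assumes "\<alpha> \<in> alt_forms V k" "\<beta> \<in> alt_forms V k"
    and "\<And>xs. length xs = k \<Longrightarrow> set xs \<subseteq> carrier V \<Longrightarrow> \<alpha> xs = \<beta> xs"
  shows "\<alpha> = \<beta>"
proof
  show "\<alpha> xs = \<beta> xs" for xs
    using assms alt_forms_support [of \<alpha> V k xs] alt_forms_support [of \<beta> V k xs]
    by (cases "length xs = k \<and> set xs \<subseteq> carrier V") auto
qed

text \<open>The slot-wise conditions in the definition of alternating forms, restated for lists of the shape
  \<open>ps @ x # qs\<close>, which suits inductions over \<open>ps\<close>. The lists \<open>ps\<close> and \<open>qs\<close> are arbitrary because forms
  vanish outside their domain.\<close>

lemma alt_forms_add:
  assumes "\<omega> \<in> alt_forms V k" "x \<in> carrier V" "y \<in> carrier V"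
    and "x \<oplus>\<^bsub>V\<^esub> y \<in> carrier V"
  shows "\<omega> (ps @ (x \<oplus>\<^bsub>V\<^esub> y) # qs) = \<omega> (ps @ x # qs) + \<omega> (ps @ y # qs)"
proof (cases "length (ps @ x # qs) = k \<and> set (ps @ qs) \<subseteq> carrier V")
  case True
  then have "\<forall>i<k. \<omega> ((ps @ x # qs)[i := x \<oplus>\<^bsub>V\<^esub> y])
      = \<omega> ((ps @ x # qs)[i := x]) + \<omega> ((ps @ x # qs)[i := y])"
    using assms unfolding alt_forms_def by (auto simp del: list_update_append1)
  from this [rule_format, of "length ps"] True show ?thesis
    by simp
next
  case False
  then show ?thesis
    using assms by (subst (1 2 3) alt_forms_support [OF assms(1)]) auto
qed

lemma alt_forms_smult:
  assumes "\<omega> \<in> alt_forms V k" "x \<in> carrier V" "c \<odot>\<^bsub>V\<^esub> x \<in> carrier V"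
  shows "\<omega> (ps @ (c \<odot>\<^bsub>V\<^esub> x) # qs) = c * \<omega> (ps @ x # qs)"
proof (cases "length (ps @ x # qs) = k \<and> set (ps @ qs) \<subseteq> carrier V")
  case True
  then have "\<forall>i<k. \<omega> ((ps @ x # qs)[i := c \<odot>\<^bsub>V\<^esub> x]) = c * \<omega> ((ps @ x # qs)[i := x])"
    using assms unfolding alt_forms_def by auto
  from this [rule_format, of "length ps"] True show ?thesis
    by simp
next
  case False
  then show ?thesis
    using assms by (subst (1 2) alt_forms_support [OF assms(1)]) auto
qed

lemma alt_forms_repeat:
  assumes "\<omega> \<in> alt_forms V k"
  shows "\<omega> (ps @ x # ms @ x # qs) = 0"
proof (cases "length (ps @ x # ms @ x # qs) = k \<and> set (ps @ x # ms @ x # qs) \<subseteq> carrier V")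
  case True
  define xs where "xs = ps @ x # ms @ x # qs"
  define j where "j = length ps + Suc (length ms)"
  have "xs ! length ps = x" "xs ! j = x"
    by (simp_all add: xs_def j_def nth_append)
  moreover have alternating: "\<forall>xs i j. length xs = k \<and> set xs \<subseteq> carrier V \<and> i < j \<and> j < k \<and> xs ! i = xs ! j
      \<longrightarrow> \<omega> xs = 0"
    using assms unfolding alt_forms_def by (elim CollectE conjE)
  moreover have "length ps < j" "j < k"
    using True by (auto simp: j_def)
  ultimately show ?thesis
    using alternating [rule_format, of xs "length ps" j] True unfolding xs_def [symmetric] by simp
next
  case False
  then show ?thesis
    using alt_forms_support [OF assms] by blast
qed

lemma alt_forms_sum_closed:
  assumes "\<alpha> \<in> alt_forms V k" "\<beta> \<in> alt_forms V k"
  shows "(\<lambda>xs. \<alpha> xs + \<beta> xs) \<in> alt_forms V k"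
  using assms unfolding alt_forms_def by (simp add: algebra_simps)

lemma alt_forms_scale_closed:
  assumes "\<alpha> \<in> alt_forms V k"
  shows "(\<lambda>xs. c * \<alpha> xs) \<in> alt_forms V k"
  using assms unfolding alt_forms_def by (simp add: algebra_simps)

lemma alt_forms_big_sum_closed:
  assumes "\<And>i. i \<in> I \<Longrightarrow> \<alpha> i \<in> alt_forms V k"
  shows "(\<lambda>xs. \<Sum>i\<in>I. \<alpha> i xs) \<in> alt_forms V k"
  using assms by (induction I rule: infinite_finite_induct) (simp_all add: alt_forms_sum_closed)

lemma twist_alt_form:
  assumes "\<omega> \<in> alt_forms V k"
  shows "twist \<omega> = (\<lambda>xs. (-1) ^ k * \<omega> xs)"
proof
  show "twist \<omega> xs = (-1) ^ k * \<omega> xs" for xs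
    using alt_forms_support [OF assms, of xs] by (cases "length xs = k") (auto simp: twist_def)
qed

lemma twist_alt_forms_closed:
  assumes "\<omega> \<in> alt_forms V k"
  shows "twist \<omega> \<in> alt_forms V k"
  using alt_forms_scale_closed [OF assms] twist_alt_form [OF assms] by simp

lemma contract_degree_zero:
  assumes "\<omega> \<in> alt_forms V 0"
  shows "contract x \<omega> = (\<lambda>xs. 0)"
  using alt_forms_support [OF assms] by (auto simp: contract_def)

lemma contract_outside:
  assumes "\<omega> \<in> alt_forms V k" "x \<notin> carrier V"
  shows "contract x \<omega> = (\<lambda>xs. 0)"
  using alt_forms_support [OF assms(1)] assms(2) by (auto simp: contract_def)

lemma contract_contract_same:
  assumes "\<omega> \<in> alt_forms V k"
  shows "contract x (contract x \<omega>) = (\<lambda>xs. 0)"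
  using alt_forms_repeat [OF assms, of "[]" x "[]"] by (simp add: contract_def)

lemma contract_one_form:
  assumes "\<phi> \<in> alt_forms V 1"
  shows "contract x \<phi> = (\<lambda>xs. \<phi> [x] * unit_form xs)"
proof
  show "contract x \<phi> xs = \<phi> [x] * unit_form xs" for xs
    using alt_forms_support [OF assms, of "x # xs"] by (auto simp: contract_def unit_form_def)
qed

lemma unit_form_alt: "unit_form \<in> alt_forms V 0"
  by (auto simp: alt_forms_def unit_form_def)

lemma degree_zero_form:
  assumes "\<omega> \<in> alt_forms V 0"
  shows "\<omega> = (\<lambda>xs. \<omega> [] * unit_form xs)"
  using alt_forms_support [OF assms] by (auto simp: unit_form_def)

text \<open>Forms vanish outside the carrier, so additivity can be used only for sums that stay inside it. For
  a quotient this closure is much cheaper to check than the vector space axioms.\<close>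

locale additive_space =
  fixes V :: "(real, 'b, 'm) module_scheme" (structure)
  assumes add_closed: "\<lbrakk>x \<in> carrier V; y \<in> carrier V\<rbrakk> \<Longrightarrow> x \<oplus> y \<in> carrier V"
begin

text \<open>Expand \<open>\<omega>(\<dots>, x + y, x + y, \<dots>) = 0\<close>.\<close>

lemma swap_adjacent:
  fixes \<omega> :: "'b list \<Rightarrow> real"
  assumes add: "\<And>ps qs x y. x \<in> carrier V \<Longrightarrow> y \<in> carrier V
      \<Longrightarrow> \<omega> (ps @ (x \<oplus> y) # qs) = \<omega> (ps @ x # qs) + \<omega> (ps @ y # qs)"
    and alt: "\<And>ps qs x. \<omega> (ps @ x # x # qs) = 0"
    and x: "x \<in> carrier V" and y: "y \<in> carrier V"
  shows "\<omega> (ps @ x # y # qs) = - \<omega> (ps @ y # x # qs)"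
proof -
  have "0 = \<omega> (ps @ (x \<oplus> y) # (x \<oplus> y) # qs)"
    by (simp add: alt)
  also have "\<dots> = \<omega> (ps @ x # (x \<oplus> y) # qs) + \<omega> (ps @ y # (x \<oplus> y) # qs)"
    by (rule add [OF x y])
  also have "\<dots> = \<omega> (ps @ x # y # qs) + \<omega> (ps @ y # x # qs)"
    using add [OF x y, of "ps @ [x]" qs] add [OF x y, of "ps @ [y]" qs] by (simp add: alt)
  finally show ?thesis
    by simp
qed

text \<open>It suffices to test alternation on equal neighbours: two equal arguments further apart are brought
  together by adjacent swaps, each of which only changes the sign.\<close>

lemma alt_formsI:
  assumes support: "\<And>xs. length xs \<noteq> k \<or> \<not> set xs \<subseteq> carrier V \<Longrightarrow> \<omega> xs = 0"
    and add: "\<And>ps qs x y. x \<in> carrier V \<Longrightarrow> y \<in> carrier V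
      \<Longrightarrow> \<omega> (ps @ (x \<oplus> y) # qs) = \<omega> (ps @ x # qs) + \<omega> (ps @ y # qs)"
    and smult: "\<And>ps qs c x. x \<in> carrier V \<Longrightarrow> \<omega> (ps @ (c \<odot> x) # qs) = c * \<omega> (ps @ x # qs)"
    and alt: "\<And>ps qs x. \<omega> (ps @ x # x # qs) = 0"
  shows "\<omega> \<in> alt_forms V k"
proof -
  have repeat: "\<omega> (ps @ x # ms @ x # qs) = 0" if "set (x # ms) \<subseteq> carrier V" for ps ms qs x
    using that
  proof (induction ms arbitrary: ps)
    case Nil
    then show ?case by (simp add: alt)
  next
    case (Cons y ms)
    have "\<omega> (ps @ x # y # ms @ x # qs) = - \<omega> (ps @ y # x # ms @ x # qs)"
      using Cons.prems by (intro swap_adjacent [OF add alt]) auto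
    also have "\<dots> = 0"
      using Cons.IH [of "ps @ [y]"] Cons.prems by simp
    finally show ?case
      by simp
  qed
  show ?thesis
    unfolding alt_forms_def
  proof (intro CollectI conjI allI impI; (elim conjE)?)
    fix xs assume "\<not> (length xs = k \<and> set xs \<subseteq> carrier V)"
    then show "\<omega> xs = 0" using support by blast
  next
    fix xs i x y assume "length xs = k" "set xs \<subseteq> carrier V" "i < k" "x \<in> carrier V" "y \<in> carrier V"
    then show "\<omega> (xs[i := x \<oplus> y]) = \<omega> (xs[i := x]) + \<omega> (xs[i := y])"
      using add by (simp add: upd_conv_take_nth_drop)
  next
    fix xs i c x assume "length xs = k" "set xs \<subseteq> carrier V" "i < k" "x \<in> carrier V"
    then show "\<omega> (xs[i := c \<odot> x]) = c * \<omega> (xs[i := x])"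
      using smult by (simp add: upd_conv_take_nth_drop)
  next
    fix xs i j assume xs: "length xs = k" "set xs \<subseteq> carrier V" and ij: "i < j" "j < k" "xs ! i = xs ! j"
    define ms where "ms = drop (Suc i) (take j xs)"
    have "take j xs = take i xs @ xs ! i # ms"
      using id_take_nth_drop [of i "take j xs"] ij xs(1) by (simp add: ms_def min_absorb1)
    then have "xs = take i xs @ xs ! i # ms @ xs ! i # drop (Suc j) xs"
      using id_take_nth_drop [of j xs] ij xs(1) by simp
    moreover have "set (xs ! i # ms) \<subseteq> carrier V"
      using xs ij set_drop_subset [of "Suc i" "take j xs"] set_take_subset [of j xs]
      by (auto simp: ms_def)
    ultimately show "\<omega> xs = 0"
      using repeat by metis
  qed
qed

lemma alt_forms_additive:
  assumes "\<omega> \<in> alt_forms V k" "x \<in> carrier V" "y \<in> carrier V"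
  shows "\<omega> (ps @ (x \<oplus> y) # qs) = \<omega> (ps @ x # qs) + \<omega> (ps @ y # qs)"
  using alt_forms_add [OF assms] add_closed assms by blast

lemma contract_swap:
  assumes \<omega>: "\<omega> \<in> alt_forms V k"
  shows "contract x (contract y \<omega>) = (\<lambda>xs. - contract y (contract x \<omega>) xs)"
proof (cases "x \<in> carrier V \<and> y \<in> carrier V")
  case True
  have "\<omega> ([] @ y # x # xs) = - \<omega> ([] @ x # y # xs)" for xs
    using alt_forms_repeat [OF \<omega>, of _ _ "[]"] True
    by (intro swap_adjacent alt_forms_additive [OF \<omega>]) auto
  then show ?thesis
    by (simp add: contract_def)
next
  case False
  then show ?thesis
    using contract_outside [OF \<omega>] alt_forms_support [OF \<omega>] by (auto simp: contract_def)
qed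

end

locale linear_space = additive_space +
  assumes smult_closed: "x \<in> carrier V \<Longrightarrow> c \<odot> x \<in> carrier V"
begin

text \<open>For \<open>k = 0\<close> the interior product is zero, and zero has every degree; the truncated difference
  \<open>k - 1\<close> therefore spares a case distinction.\<close>

lemma contract_alt:
  assumes \<omega>: "\<omega> \<in> alt_forms V k"
  shows "contract x \<omega> \<in> alt_forms V (k - 1)"
proof (cases "k = 0 \<or> x \<notin> carrier V")
  case True
  then show ?thesis
    using contract_degree_zero contract_outside \<omega> by fastforce
next
  case False
  show ?thesis
  proof (rule alt_formsI)
    show "contract x \<omega> xs = 0" if "length xs \<noteq> k - 1 \<or> \<not> set xs \<subseteq> carrier V" for xs
      using that False alt_forms_support [OF \<omega>, of "x # xs"] by (auto simp: contract_def)
  next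
    show "contract x \<omega> (ps @ (y \<oplus> z) # qs) = contract x \<omega> (ps @ y # qs) + contract x \<omega> (ps @ z # qs)"
      if "y \<in> carrier V" "z \<in> carrier V" for ps qs y z
      using alt_forms_additive [OF \<omega> that, of "x # ps"] by (simp add: contract_def)
    show "contract x \<omega> (ps @ (c \<odot> y) # qs) = c * contract x \<omega> (ps @ y # qs)"
      if "y \<in> carrier V" for ps qs c y
      using alt_forms_smult [OF \<omega> that smult_closed [OF that], of "x # ps"] by (simp add: contract_def)
    show "contract x \<omega> (ps @ y # y # qs) = 0" for ps qs y
      using alt_forms_repeat [OF \<omega>, of "x # ps" y "[]"] by (simp add: contract_def)
  qed
qed

lemma contract_add:
  assumes "\<omega> \<in> alt_forms V k" "x \<in> carrier V" "y \<in> carrier V"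
  shows "contract (x \<oplus> y) \<omega> = (\<lambda>xs. contract x \<omega> xs + contract y \<omega> xs)"
  using alt_forms_additive [OF assms, of "[]"] by (simp add: contract_def)

lemma contract_smult:
  assumes "\<omega> \<in> alt_forms V k" "x \<in> carrier V"
  shows "contract (c \<odot> x) \<omega> = (\<lambda>xs. c * contract x \<omega> xs)"
  using alt_forms_smult [OF assms smult_closed [OF assms(2)], of "[]"] by (simp add: contract_def)

text \<open>All three conditions are checked by moving the arguments before the critical slot into the factors,
  one at a time, with the recursion for the exterior product. At the slot itself, equal neighbours
  \<open>x, x\<close> leave the two mixed terms, which cancel because the interior product by \<open>x\<close>
  anticommutes with the grading involution.\<close>

lemma wedge_alt:
  assumes "\<alpha> \<in> alt_forms V k" "\<beta> \<in> alt_forms V l"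
  shows "wedge \<alpha> \<beta> \<in> alt_forms V (k + l)"
proof (rule alt_formsI)
  fix xs assume xs: "length xs \<noteq> k + l \<or> \<not> set xs \<subseteq> carrier V"
  have "\<alpha> (nths xs S) * \<beta> (nths xs (- S)) = 0" for S
  proof (rule ccontr)
    assume "\<alpha> (nths xs S) * \<beta> (nths xs (- S)) \<noteq> 0"
    then have "length (nths xs S) = k" "set (nths xs S) \<subseteq> carrier V"
      "length (nths xs (- S)) = l" "set (nths xs (- S)) \<subseteq> carrier V"
      using alt_forms_support [OF assms(1)] alt_forms_support [OF assms(2)] by auto
    moreover have "length xs = length (nths xs S) + length (nths xs (- S))"
    proof -
      have "card {i. i < length xs \<and> i \<in> S} + card {i. i < length xs \<and> i \<in> - S}
          = card ({i. i < length xs \<and> i \<in> S} \<union> {i. i < length xs \<and> i \<in> - S})"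
        by (rule card_Un_disjoint [symmetric]) auto
      also have "{i. i < length xs \<and> i \<in> S} \<union> {i. i < length xs \<and> i \<in> - S} = {..<length xs}"
        by auto
      finally show ?thesis
        by (simp add: length_nths)
    qed
    moreover have "set xs = set (nths xs S) \<union> set (nths xs (- S))"
      unfolding set_nths set_conv_nth [of xs] by blast
    ultimately show False
      using xs by auto
  qed
  then show "wedge \<alpha> \<beta> xs = 0"
    by (simp add: wedge_def mult.assoc)
next
  fix ps qs x y assume xy: "x \<in> carrier V" "y \<in> carrier V"
  show "wedge \<alpha> \<beta> (ps @ (x \<oplus> y) # qs) = wedge \<alpha> \<beta> (ps @ x # qs) + wedge \<alpha> \<beta> (ps @ y # qs)"
    using assms
  proof (induction ps arbitrary: \<alpha> \<beta> k l)
    case Nil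
    then show ?case
      using xy by (simp add: wedge_Cons contract_add wedge_add_left wedge_add_right)
  next
    case (Cons p ps)
    show ?case
      using Cons.IH [OF contract_alt [OF Cons.prems(1)] Cons.prems(2)]
        Cons.IH [OF twist_alt_forms_closed [OF Cons.prems(1)] contract_alt [OF Cons.prems(2)]]
      by (simp add: wedge_Cons)
  qed
next
  fix ps qs c x assume x: "x \<in> carrier V"
  show "wedge \<alpha> \<beta> (ps @ (c \<odot> x) # qs) = c * wedge \<alpha> \<beta> (ps @ x # qs)"
    using assms
  proof (induction ps arbitrary: \<alpha> \<beta> k l)
    case Nil
    then show ?case
      using x by (simp add: wedge_Cons contract_smult wedge_scale_left wedge_scale_right algebra_simps)
  next
    case (Cons p ps)
    show ?case
      using Cons.IH [OF contract_alt [OF Cons.prems(1)] Cons.prems(2)]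
        Cons.IH [OF twist_alt_forms_closed [OF Cons.prems(1)] contract_alt [OF Cons.prems(2)]]
      by (simp add: wedge_Cons algebra_simps)
  qed
next
  fix ps qs x
  show "wedge \<alpha> \<beta> (ps @ x # x # qs) = 0"
    using assms
  proof (induction ps arbitrary: \<alpha> \<beta> k l)
    case Nil
    show ?case
      by (simp add: wedge_Cons contract_wedge contract_contract_same [OF Nil(1)]
          contract_contract_same [OF Nil(2)] contract_twist wedge_uminus_left)
  next
    case (Cons p ps)
    show ?case
      using Cons.IH [OF contract_alt [OF Cons.prems(1)] Cons.prems(2)]
        Cons.IH [OF twist_alt_forms_closed [OF Cons.prems(1)] contract_alt [OF Cons.prems(2)]]
      by (simp add: wedge_Cons)
  qed
qed

lemma wedge_commute:
  assumes "\<alpha> \<in> alt_forms V k" "\<beta> \<in> alt_forms V l"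
  shows "wedge \<alpha> \<beta> = (\<lambda>xs. (-1) ^ (k * l) * wedge \<beta> \<alpha> xs)"
  by (rule wedge_commute_parity [OF twist_alt_form twist_alt_form]) fact+

end

section \<open>The Euler identity and uniqueness of the differential\<close>

lemma cochains_simps [simp]:
  "carrier (cochains V k) = alt_forms V k"
  "zero (cochains V k) = (\<lambda>xs. 0)"
  "add (cochains V k) = (\<lambda>\<alpha> \<beta> xs. \<alpha> xs + \<beta> xs)"
  "module.smult (cochains V k) = (\<lambda>c \<alpha> xs. c * \<alpha> xs)"
  by (simp_all add: cochains_def)

lemma cochains_vectorspace: "vectorspace class_ring (cochains V k)"
proof (rule vs_criteria)
  show "\<forall>v\<in>carrier (cochains V k). \<exists>w\<in>carrier (cochains V k). v \<oplus>\<^bsub>cochains V k\<^esub> w = \<zero>\<^bsub>cochains V k\<^esub>"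
  proof
    fix v assume "v \<in> carrier (cochains V k)"
    then have "(\<lambda>xs. - 1 * v xs) \<in> alt_forms V k"
      using alt_forms_scale_closed [of v V k "- 1"] by auto
    then show "\<exists>w\<in>carrier (cochains V k). v \<oplus>\<^bsub>cochains V k\<^esub> w = \<zero>\<^bsub>cochains V k\<^esub>"
      by (intro bexI) auto
  qed
qed (auto simp: class_field alt_forms_sum_closed alt_forms_scale_closed algebra_simps)

lemma linear_map_cochainsI:
  assumes "\<And>\<alpha>. \<alpha> \<in> alt_forms V k \<Longrightarrow> D \<alpha> \<in> alt_forms W l"
    and "\<And>\<alpha> \<beta>. \<alpha> \<in> alt_forms V k \<Longrightarrow> \<beta> \<in> alt_forms V k \<Longrightarrow> D (\<lambda>xs. \<alpha> xs + \<beta> xs) = (\<lambda>xs. D \<alpha> xs + D \<beta> xs)"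
    and "\<And>c \<alpha>. \<alpha> \<in> alt_forms V k \<Longrightarrow> D (\<lambda>xs. c * \<alpha> xs) = (\<lambda>xs. c * D \<alpha> xs)"
  shows "linear_map class_ring (cochains V k) (cochains W l) D"
proof -
  interpret A: vectorspace class_ring "cochains V k" by (rule cochains_vectorspace)
  interpret B: vectorspace class_ring "cochains W l" by (rule cochains_vectorspace)
  show ?thesis
    by unfold_locales (use assms in \<open>auto simp: LinearCombinations.module_hom_def\<close>)
qed

lemma is_CE_differentialD:
  assumes "is_CE_differential g D"
  shows "D \<in> extensional (\<Union>k. alt_forms g k)"
    and "\<alpha> \<in> alt_forms g k \<Longrightarrow> D \<alpha> \<in> alt_forms g (Suc k)"
    and "\<alpha> \<in> alt_forms g k \<Longrightarrow> \<beta> \<in> alt_forms g k \<Longrightarrow> D (\<lambda>xs. \<alpha> xs + \<beta> xs) = (\<lambda>xs. D \<alpha> xs + D \<beta> xs)"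
    and "\<alpha> \<in> alt_forms g k \<Longrightarrow> D (\<lambda>xs. c * \<alpha> xs) = (\<lambda>xs. c * D \<alpha> xs)"
    and "\<alpha> \<in> alt_forms g k \<Longrightarrow> \<beta> \<in> alt_forms g l
      \<Longrightarrow> D (wedge \<alpha> \<beta>) = (\<lambda>xs. wedge (D \<alpha>) \<beta> xs + (-1) ^ k * wedge \<alpha> (D \<beta>) xs)"
    and "\<phi> \<in> alt_forms g 1 \<Longrightarrow> x \<in> carrier g \<Longrightarrow> y \<in> carrier g \<Longrightarrow> D \<phi> [x, y] = \<phi> [bracket g x y]"
proof -
  have "linear_map class_ring (cochains g k) (cochains g (Suc k)) D"
    using assms by (simp add: is_CE_differential_def)
  then have hom: "D \<in> LinearCombinations.module_hom class_ring (cochains g k) (cochains g (Suc k))"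
    by (simp add: linear_map_def mod_hom_def mod_hom_axioms_def)
  show "\<alpha> \<in> alt_forms g k \<Longrightarrow> D \<alpha> \<in> alt_forms g (Suc k)"
    using LinearCombinations.module_hom_closed [OF hom] by auto
  show "\<alpha> \<in> alt_forms g k \<Longrightarrow> \<beta> \<in> alt_forms g k \<Longrightarrow> D (\<lambda>xs. \<alpha> xs + \<beta> xs) = (\<lambda>xs. D \<alpha> xs + D \<beta> xs)"
    using LinearCombinations.module_hom_add [OF hom, of \<alpha> \<beta>] by simp
  show "\<alpha> \<in> alt_forms g k \<Longrightarrow> D (\<lambda>xs. c * \<alpha> xs) = (\<lambda>xs. c * D \<alpha> xs)"
    using LinearCombinations.module_hom_smult [OF hom, of c \<alpha>] by simp
qed (use assms in \<open>auto simp: is_CE_differential_def\<close>)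

text \<open>A basis \<open>e\<close> with dual basis \<open>\<phi>\<close>, expressed through the values of one-forms, so that no linear
  combinations in the carrier have to be formed.\<close>

locale dual_basis_space = linear_space +
  fixes e :: "nat \<Rightarrow> 'b" and \<phi> :: "nat \<Rightarrow> 'b list \<Rightarrow> real" and m :: nat
  assumes basis_closed: "i < m \<Longrightarrow> e i \<in> carrier V"
    and dual_alt: "i < m \<Longrightarrow> \<phi> i \<in> alt_forms V 1"
    and one_form_expand: "\<lbrakk>\<psi> \<in> alt_forms V 1; x \<in> carrier V\<rbrakk> \<Longrightarrow> \<psi> [x] = (\<Sum>i<m. \<phi> i [x] * \<psi> [e i])"
begin

lemma expand_first:
  assumes \<omega>: "\<omega> \<in> alt_forms V k" and x: "x \<in> carrier V"
  shows "\<omega> (x # xs) = (\<Sum>i<m. \<phi> i [x] * \<omega> (e i # xs))"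
proof -
  \<comment> \<open>The value as a function of the first argument alone, made into a one-form.\<close>
  define \<psi> where "\<psi> ys = (if length ys = 1 \<and> set ys \<subseteq> carrier V then \<omega> (hd ys # xs) else 0)" for ys
  have add: "\<omega> ((y \<oplus> z) # xs) = \<omega> (y # xs) + \<omega> (z # xs)"
    if "y \<in> carrier V" "z \<in> carrier V" for y z
    using alt_forms_additive [OF \<omega> that, of "[]"] by simp
  have smult: "\<omega> ((c \<odot> y) # xs) = c * \<omega> (y # xs)" if "y \<in> carrier V" for c y
    using alt_forms_smult [OF \<omega> that smult_closed [OF that], of "[]"] by simp
  have "\<psi> \<in> alt_forms V 1"
    by (rule alt_formsI) (auto simp: \<psi>_def add smult add_closed smult_closed)
  from one_form_expand [OF this x] show ?thesis
    using x basis_closed by (simp add: \<psi>_def)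
qed

text \<open>Contracting with \<open>e\<^sub>i\<close> and multiplying by \<open>\<phi>\<^sub>i\<close> replaces one argument \<open>x\<close> by its expansion in the
  basis; summed over \<open>i\<close>, each of the arguments contributes the value of the form once.\<close>

lemma euler_identity_at:
  assumes "\<omega> \<in> alt_forms V k" "set xs \<subseteq> carrier V"
  shows "(\<Sum>i<m. wedge (\<phi> i) (contract (e i) \<omega>) xs) = real (length xs) * \<omega> xs"
  using assms
proof (induction xs arbitrary: \<omega> k)
  case Nil
  have "\<phi> i [] = 0" if "i < m" for i
    using alt_forms_support [OF dual_alt [OF that], of "[]"] by simp
  then show ?case by simp
next
  case (Cons x xs)
  have "wedge (\<phi> i) (contract (e i) \<omega>) (x # xs)
      = \<phi> i [x] * \<omega> (e i # xs) + wedge (\<phi> i) (contract (e i) (contract x \<omega>)) xs" if "i < m" for i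
    using that contract_swap [OF Cons.prems(1), of x "e i"]
    by (simp add: wedge_Cons contract_one_form [OF dual_alt] twist_alt_form [OF dual_alt]
        wedge_scale_left wedge_uminus_left wedge_uminus_right) (simp add: contract_def)
  then have "(\<Sum>i<m. wedge (\<phi> i) (contract (e i) \<omega>) (x # xs))
      = (\<Sum>i<m. \<phi> i [x] * \<omega> (e i # xs)) + (\<Sum>i<m. wedge (\<phi> i) (contract (e i) (contract x \<omega>)) xs)"
    by (simp add: sum.distrib)
  also have "\<dots> = \<omega> (x # xs) + real (length xs) * contract x \<omega> xs"
    using expand_first [OF Cons.prems(1), of x xs] Cons.IH [OF contract_alt [OF Cons.prems(1)]] Cons.prems(2)
    by simp
  finally show ?case
    by (simp add: contract_def algebra_simps)
qed

text \<open>This identity is used three times: it generates all forms from one-forms (uniqueness of the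
  differential), it computes the commutator of the Lefschetz operator with its dual, and it
  propagates exactness to higher degrees.\<close>

lemma euler_identity:
  assumes \<omega>: "\<omega> \<in> alt_forms V k"
  shows "(\<lambda>xs. \<Sum>i<m. wedge (\<phi> i) (contract (e i) \<omega>) xs) = (\<lambda>xs. real k * \<omega> xs)"
proof (cases k)
  case 0
  then show ?thesis
    using contract_degree_zero [of \<omega> V] \<omega> by simp
next
  case (Suc l)
  have "wedge (\<phi> i) (contract (e i) \<omega>) \<in> alt_forms V k" if "i < m" for i
    using wedge_alt [OF dual_alt contract_alt, OF that \<omega>] Suc by simp
  then show ?thesis
    using euler_identity_at [OF \<omega>]
    by (intro alt_forms_eqI [of _ V k] alt_forms_big_sum_closed alt_forms_scale_closed \<omega>) auto
qed

end

text \<open>A derivation kills the constant form \<open>1\<close> because \<open>1 = 1 \<and> 1\<close>, and on one-forms it is prescribed by the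
  bracket. The Euler identity writes a form of positive degree as a sum of products of a one-form
  with a form of smaller degree, so the rest follows by induction on the degree.\<close>

lemma CE_differential_unique:
  fixes g :: "(real, 'b, 'm) lie_scheme"
  assumes basis: "dual_basis_space g e \<phi> m"
    and D: "is_CE_differential g D" and D': "is_CE_differential g D'"
  shows "D = D'"
proof -
  interpret dual_basis_space g e \<phi> m by (rule basis)
  have unit: "D unit_form = (\<lambda>xs. 0)" if "is_CE_differential g D" for D
    using is_CE_differentialD(5) [OF that unit_form_alt unit_form_alt] by (simp add: fun_eq_iff)
  have sum: "D (\<lambda>xs. \<Sum>i<r. \<alpha> i xs) = (\<lambda>xs. \<Sum>i<r. D (\<alpha> i) xs)"
    if D: "is_CE_differential g D" and "\<And>i. i < r \<Longrightarrow> \<alpha> i \<in> alt_forms g k" for D \<alpha> k and r :: nat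
    using that(2)
  proof (induction r)
    case 0
    then show ?case
      using is_CE_differentialD(4) [OF D unit_form_alt, of 0] by simp
  next
    case (Suc r)
    then show ?case
      using is_CE_differentialD(3) [OF D alt_forms_big_sum_closed [of "{..<r}" \<alpha> _ k], of "\<alpha> r"] by simp
  qed
  have one_forms: "D \<psi> = D' \<psi>" if \<psi>: "\<psi> \<in> alt_forms g 1" for \<psi>
  proof (rule alt_forms_eqI)
    show "D \<psi> \<in> alt_forms g (Suc 1)" "D' \<psi> \<in> alt_forms g (Suc 1)"
      using is_CE_differentialD(2) D D' \<psi> by blast+
    fix xs assume "length xs = Suc 1" "set xs \<subseteq> carrier g"
    then obtain x y where "xs = [x, y]" "x \<in> carrier g" "y \<in> carrier g"
      by (auto simp: length_Suc_conv)
    then show "D \<psi> xs = D' \<psi> xs"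
      using is_CE_differentialD(6) [OF D \<psi>] is_CE_differentialD(6) [OF D' \<psi>] by simp
  qed
  have agree: "D \<omega> = D' \<omega>" if "\<omega> \<in> alt_forms g k" for \<omega> k
    using that
  proof (induction k arbitrary: \<omega>)
    case 0
    have "D (\<lambda>xs. \<omega> [] * unit_form xs) = D' (\<lambda>xs. \<omega> [] * unit_form xs)"
      unfolding is_CE_differentialD(4) [OF D unit_form_alt] is_CE_differentialD(4) [OF D' unit_form_alt]
      by (simp add: unit D D')
    then show ?case
      by (simp flip: degree_zero_form [OF 0])
  next
    case (Suc k)
    let ?\<alpha> = "\<lambda>i. wedge (\<phi> i) (contract (e i) \<omega>)"
    have c: "contract (e i) \<omega> \<in> alt_forms g k" for i
      using contract_alt [OF Suc.prems] by simp
    have \<alpha>: "?\<alpha> i \<in> alt_forms g (Suc k)" if "i < m" for i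
      using wedge_alt [OF dual_alt [OF that] c] by simp
    have "D (?\<alpha> i) = D' (?\<alpha> i)" if "i < m" for i
      unfolding is_CE_differentialD(5) [OF D dual_alt [OF that] c]
        is_CE_differentialD(5) [OF D' dual_alt [OF that] c]
      by (simp only: one_forms [OF dual_alt [OF that]] Suc.IH [OF c])
    moreover have "D (\<lambda>xs. \<Sum>i<m. ?\<alpha> i xs) = (\<lambda>xs. \<Sum>i<m. D (?\<alpha> i) xs)"
      by (rule sum [OF D \<alpha>])
    moreover have "D' (\<lambda>xs. \<Sum>i<m. ?\<alpha> i xs) = (\<lambda>xs. \<Sum>i<m. D' (?\<alpha> i) xs)"
      by (rule sum [OF D' \<alpha>])
    ultimately have "D (\<lambda>xs. \<Sum>i<m. ?\<alpha> i xs) = D' (\<lambda>xs. \<Sum>i<m. ?\<alpha> i xs)"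
      by simp
    then have "(\<lambda>xs. real (Suc k) * D \<omega> xs) = (\<lambda>xs. real (Suc k) * D' \<omega> xs)"
      unfolding euler_identity [OF Suc.prems]
        is_CE_differentialD(4) [OF D Suc.prems] is_CE_differentialD(4) [OF D' Suc.prems] .
    then show ?case
      by (simp add: fun_eq_iff del: of_nat_Suc)
  qed
  show ?thesis
    by (rule extensionalityI [OF is_CE_differentialD(1) [OF D] is_CE_differentialD(1) [OF D']])
       (use agree in blast)
qed

lemma CE_differential_eqI:
  assumes "dual_basis_space g e \<phi> m" "is_CE_differential g D"
  shows "CE_differential g = D"
  unfolding CE_differential_def using CE_differential_unique [OF assms(1)] assms(2) by blast

section \<open>The differential of the Heisenberg algebra\<close>

interpretation heis: linear_space "heisenberg n" for n
  by unfold_locales auto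

definition heis_coord :: "nat \<Rightarrow> nat \<Rightarrow> real vec list \<Rightarrow> real" where
  "heis_coord n i = (\<lambda>xs. if length xs = 1 \<and> set xs \<subseteq> carrier (heisenberg n) then hd xs $ i else 0)"

lemma heis_coord_apply: "x \<in> carrier (heisenberg n) \<Longrightarrow> heis_coord n i [x] = x $ i"
  by (simp add: heis_coord_def)

lemma heis_coord_alt:
  assumes "i < 2 * n + 1"
  shows "heis_coord n i \<in> alt_forms (heisenberg n) 1"
  by (rule heis.alt_formsI) (use assms in \<open>auto simp: heis_coord_def\<close>)

lemma heis_one_form_expand:
  assumes \<psi>: "\<psi> \<in> alt_forms (heisenberg n) 1" and x: "x \<in> carrier (heisenberg n)"
  shows "\<psi> [x] = (\<Sum>i<2 * n + 1. heis_coord n i [x] * \<psi> [unit_vec (2 * n + 1) i])"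
proof -
  \<comment> \<open>Cut \<open>x\<close> off after \<open>r\<close> coordinates and add them one by one.\<close>
  define trunc where "trunc r = vec (2 * n + 1) (\<lambda>i. if i < r then x $ i else 0)" for r
  have partial: "\<psi> [trunc r] = (\<Sum>i<r. x $ i * \<psi> [unit_vec (2 * n + 1) i])" if "r \<le> 2 * n + 1" for r
    using that
  proof (induction r)
    case 0
    have "trunc 0 = 0 \<cdot>\<^sub>v x"
      using x by (auto simp: trunc_def)
    then have "\<psi> [trunc 0] = 0 * \<psi> [x]"
      using alt_forms_smult [OF \<psi> x heis.smult_closed [OF x], of "[]" 0 "[]"] by simp
    then show ?case by simp
  next
    case (Suc r)
    have "trunc (Suc r) = trunc r + x $ r \<cdot>\<^sub>v unit_vec (2 * n + 1) r"
      using Suc.prems by (intro eq_vecI) (auto simp: trunc_def unit_vec_def less_Suc_eq)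
    moreover have "trunc r \<in> carrier (heisenberg n)"
      by (simp add: trunc_def)
    ultimately show ?case
      using Suc heis.alt_forms_additive [OF \<psi>, of "trunc r" "x $ r \<cdot>\<^sub>v unit_vec (2 * n + 1) r" "[]" "[]"]
        alt_forms_smult [OF \<psi>, of "unit_vec (2 * n + 1) r" "x $ r" "[]" "[]"]
      by simp
  qed
  moreover have "trunc (2 * n + 1) = x"
    using x by (auto simp: trunc_def)
  ultimately show ?thesis
    using x partial [of "2 * n + 1"] by (simp add: heis_coord_apply)
qed

interpretation heis: dual_basis_space "heisenberg n" "unit_vec (2 * n + 1)" "heis_coord n" "2 * n + 1" for n
  by unfold_locales (simp, rule heis_coord_alt, assumption, rule heis_one_form_expand)

lemma contract_heis_coord:
  assumes "i < 2 * n + 1" "x \<in> carrier (heisenberg n)"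
  shows "contract x (heis_coord n i) = (\<lambda>xs. x $ i * unit_form xs)"
  using contract_one_form [OF heis_coord_alt [OF assms(1)]] heis_coord_apply [OF assms(2)] by simp

text \<open>The differential of the coordinate dual to \<open>z\<close>, a symplectic form on the span of the \<open>y\<^sub>i\<close>.\<close>

definition heis_symplectic :: "nat \<Rightarrow> real vec list \<Rightarrow> real" where
  "heis_symplectic n = (\<lambda>xs. \<Sum>j<n. wedge (heis_coord n (2 * j)) (heis_coord n (2 * j + 1)) xs)"

lemma heis_symplectic_alt: "heis_symplectic n \<in> alt_forms (heisenberg n) 2"
  unfolding heis_symplectic_def
proof (rule alt_forms_big_sum_closed)
  fix j assume "j \<in> {..<n}"
  then show "wedge (heis_coord n (2 * j)) (heis_coord n (2 * j + 1)) \<in> alt_forms (heisenberg n) 2"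
    using heis.wedge_alt [OF heis_coord_alt heis_coord_alt, of "2 * j" n "2 * j + 1"] by (simp add: numeral_2_eq_2)
qed

lemma contract_heis_symplectic:
  assumes "x \<in> carrier (heisenberg n)"
  shows "contract x (heis_symplectic n)
    = (\<lambda>xs. \<Sum>j<n. x $ (2 * j) * heis_coord n (2 * j + 1) xs - x $ (2 * j + 1) * heis_coord n (2 * j) xs)"
proof -
  have "contract x (wedge (heis_coord n (2 * j)) (heis_coord n (2 * j + 1)))
      = (\<lambda>xs. x $ (2 * j) * heis_coord n (2 * j + 1) xs - x $ (2 * j + 1) * heis_coord n (2 * j) xs)"
    if "j < n" for j
    using that assms twist_alt_form [OF heis_coord_alt [of "2 * j" n]]
    by (simp add: contract_wedge contract_heis_coord wedge_scale_left wedge_scale_right wedge_uminus_left)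
  then show ?thesis
    by (simp add: heis_symplectic_def contract_simps)
qed

lemma heis_bracket_symplectic:
  assumes "x \<in> carrier (heisenberg n)" "y \<in> carrier (heisenberg n)"
  shows "bracket (heisenberg n) x y = heis_symplectic n [x, y] \<cdot>\<^sub>v heis_z n"
proof -
  have "heis_symplectic n [x, y] = contract x (heis_symplectic n) [y]"
    by (simp add: contract_def)
  then show ?thesis
    using assms by (simp add: contract_heis_symplectic heis_coord_apply heis_z_def)
qed

lemma heis_z_carrier [simp]: "heis_z n \<in> carrier (heisenberg n)"
  by (simp add: heis_z_def)

lemma contract_z_coord: "i < 2 * n \<Longrightarrow> contract (heis_z n) (heis_coord n i) = (\<lambda>xs. 0)"
  using contract_heis_coord [of i n "heis_z n"] by (simp add: heis_z_def)

lemma contract_z_symplectic: "contract (heis_z n) (heis_symplectic n) = (\<lambda>xs. 0)"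
  using contract_heis_symplectic [of "heis_z n" n] by (simp add: heis_z_def)

text \<open>A form of even degree commutes with everything.\<close>

lemma symplectic_central:
  assumes "\<alpha> \<in> alt_forms (heisenberg n) k"
  shows "wedge (heis_symplectic n) (wedge \<alpha> \<beta>) = wedge \<alpha> (wedge (heis_symplectic n) \<beta>)"
  using heis.wedge_commute [OF heis_symplectic_alt assms] by (simp flip: wedge_assoc)

lemma twist_symplectic [simp]: "twist (heis_symplectic n) = heis_symplectic n"
  using twist_alt_form [OF heis_symplectic_alt] by simp

text \<open>Contraction with \<open>z\<close> is an antiderivation, and multiplying it by a central element gives a
  derivation of the same parity. On one-forms it takes the value dictated by the bracket
  \<open>[x, y] = \<Omega>(x, y) z\<close>. This yields existence of the differential without a verification of the general
  Chevalley-Eilenberg formula.\<close>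

lemma heis_CE_differential:
  "CE_differential (heisenberg n)
    = restrict (\<lambda>\<omega>. wedge (heis_symplectic n) (contract (heis_z n) \<omega>)) (\<Union>k. alt_forms (heisenberg n) k)"
    (is "_ = ?D")
proof (rule CE_differential_eqI)
  let ?g = "heisenberg n" and ?\<Omega> = "heis_symplectic n" and ?z = "heis_z n"
  show "dual_basis_space ?g (unit_vec (2 * n + 1)) (heis_coord n) (2 * n + 1)"
    by (rule heis.dual_basis_space_axioms)
  have D: "?D \<omega> = wedge ?\<Omega> (contract ?z \<omega>)" if "\<omega> \<in> alt_forms ?g k" for \<omega> k
    using that by auto
  show "is_CE_differential ?g ?D"
    unfolding is_CE_differential_def
  proof (intro conjI allI ballI)
    fix k
    show "linear_map class_ring (cochains ?g k) (cochains ?g (Suc k)) ?D"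
    proof (rule linear_map_cochainsI)
      fix \<alpha> assume \<alpha>: "\<alpha> \<in> alt_forms ?g k"
      show "?D \<alpha> \<in> alt_forms ?g (Suc k)"
      proof (cases k)
        case 0
        then show ?thesis
          using D [OF \<alpha>] contract_degree_zero [of \<alpha> ?g] \<alpha> by simp
      next
        case (Suc l)
        then show ?thesis
          using D [OF \<alpha>] heis.wedge_alt [OF heis_symplectic_alt heis.contract_alt [OF \<alpha>], of ?z] by simp
      qed
      show "?D (\<lambda>xs. c * \<alpha> xs) = (\<lambda>xs. c * ?D \<alpha> xs)" for c
        unfolding D [OF \<alpha>] D [OF alt_forms_scale_closed [OF \<alpha>]] by (simp add: contract_simps wedge_scale_right)
      fix \<beta> assume \<beta>: "\<beta> \<in> alt_forms ?g k"
      show "?D (\<lambda>xs. \<alpha> xs + \<beta> xs) = (\<lambda>xs. ?D \<alpha> xs + ?D \<beta> xs)"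
        unfolding D [OF \<alpha>] D [OF \<beta>] D [OF alt_forms_sum_closed [OF \<alpha> \<beta>]]
        by (simp add: contract_simps wedge_add_right)
    qed
  next
    fix k l \<alpha> \<beta> assume \<alpha>: "\<alpha> \<in> alt_forms ?g k" and \<beta>: "\<beta> \<in> alt_forms ?g l"
    show "?D (wedge \<alpha> \<beta>) = (\<lambda>xs. wedge (?D \<alpha>) \<beta> xs + (-1) ^ k * wedge \<alpha> (?D \<beta>) xs)"
      unfolding D [OF \<alpha>] D [OF \<beta>] D [OF heis.wedge_alt [OF \<alpha> \<beta>]]
      by (simp add: contract_wedge wedge_add_right twist_alt_form [OF \<alpha>] wedge_scale_left wedge_scale_right
          wedge_assoc symplectic_central [OF \<alpha>])
  next
    fix \<phi> x y assume \<phi>: "\<phi> \<in> alt_forms ?g 1" and x: "x \<in> carrier ?g" and y: "y \<in> carrier ?g"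
    have "\<phi> [bracket ?g x y] = ?\<Omega> [x, y] * \<phi> [?z]"
      unfolding heis_bracket_symplectic [OF x y]
      using alt_forms_smult [OF \<phi> heis_z_carrier, of "?\<Omega> [x, y]" "[]" "[]"] heis_z_carrier by simp
    then show "?D \<phi> [x, y] = \<phi> [bracket ?g x y]"
      unfolding D [OF \<phi>] by (simp add: contract_one_form [OF \<phi>] wedge_scale_right del: heisenberg_simps)
  next
    show "?D \<in> extensional (\<Union>k. alt_forms ?g k)"
      by (rule restrict_extensional)
  qed
qed

lemma heis_CE_differential_apply:
  assumes "\<omega> \<in> alt_forms (heisenberg n) k"
  shows "CE_differential (heisenberg n) \<omega> = wedge (heis_symplectic n) (contract (heis_z n) \<omega>)"
  unfolding heis_CE_differential by (rule restrict_apply') (use assms in blast)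

text \<open>Forms which vanish as soon as one argument is \<open>z\<close>; these will turn out to be the forms pulled back
  from the abelianization.\<close>

definition horizontal_forms :: "nat \<Rightarrow> nat \<Rightarrow> (real vec list \<Rightarrow> real) set" where
  "horizontal_forms n k = {\<omega> \<in> alt_forms (heisenberg n) k. contract (heis_z n) \<omega> = (\<lambda>xs. 0)}"

text \<open>Contraction with \<open>z\<close> maps all forms onto the horizontal forms of one degree less: a preimage of
  \<open>\<zeta>\<close> is the product of the coordinate of \<open>z\<close> with \<open>\<zeta>\<close>.\<close>

lemma heis_coboundaries:
  "coboundaries (heisenberg n) k
    = (if k < 2 then {\<lambda>xs. 0} else wedge (heis_symplectic n) ` horizontal_forms n (k - 2))"
proof (cases k)
  case (Suc l)
  let ?g = "heisenberg n" and ?\<Omega> = "heis_symplectic n" and ?z = "heis_z n"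
  have "coboundaries ?g k = (\<lambda>\<omega>. wedge ?\<Omega> (contract ?z \<omega>)) ` alt_forms ?g l"
    unfolding Suc coboundaries.simps by (intro image_cong refl heis_CE_differential_apply)
  also have "\<dots> = (if k < 2 then {\<lambda>xs. 0} else wedge ?\<Omega> ` horizontal_forms n (k - 2))"
  proof (cases l)
    case 0
    have "(\<lambda>\<omega>. wedge ?\<Omega> (contract ?z \<omega>)) ` alt_forms ?g 0 = (\<lambda>\<omega>. (\<lambda>xs. 0)) ` alt_forms ?g 0"
      by (intro image_cong refl) (simp add: contract_degree_zero [of _ ?g])
    moreover have "alt_forms ?g 0 \<noteq> {}"
      using alt_forms_zero_form by blast
    ultimately show ?thesis
      using 0 Suc by (simp add: image_constant_conv)
  next
    case (Suc m)
    have "contract ?z ` alt_forms ?g l = horizontal_forms n m"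
    proof (intro equalityI subsetI)
      fix \<zeta> assume "\<zeta> \<in> contract ?z ` alt_forms ?g l"
      then show "\<zeta> \<in> horizontal_forms n m"
        using heis.contract_alt [of _ n l ?z] contract_contract_same [of _ ?g l ?z] Suc
        unfolding horizontal_forms_def by fastforce
    next
      fix \<zeta> assume \<zeta>: "\<zeta> \<in> horizontal_forms n m"
      \<comment> \<open>The coordinate with index \<open>2n\<close> is the one dual to \<open>z\<close>.\<close>
      have "contract ?z (wedge (heis_coord n (2 * n)) \<zeta>) = \<zeta>"
        using \<zeta> contract_heis_coord [of "2 * n" n ?z]
        by (simp add: contract_wedge horizontal_forms_def heis_z_def)
      moreover have "wedge (heis_coord n (2 * n)) \<zeta> \<in> alt_forms ?g l"
        using heis.wedge_alt [OF heis_coord_alt, of "2 * n" n \<zeta> m] \<zeta> Suc by (simp add: horizontal_forms_def)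
      ultimately show "\<zeta> \<in> contract ?z ` alt_forms ?g l"
        by (intro image_eqI) simp_all
    qed
    moreover have "(\<lambda>\<omega>. wedge ?\<Omega> (contract ?z \<omega>)) ` alt_forms ?g l = wedge ?\<Omega> ` contract ?z ` alt_forms ?g l"
      by (rule image_image [symmetric])
    ultimately show ?thesis
      using \<open>k = Suc l\<close> Suc by simp
  qed
  finally show ?thesis .
qed simp

section \<open>The Lefschetz operator on horizontal forms\<close>

lemma horizontal_formsD:
  assumes "\<omega> \<in> horizontal_forms n k"
  shows "\<omega> \<in> alt_forms (heisenberg n) k" "contract (heis_z n) \<omega> = (\<lambda>xs. 0)"
  using assms by (simp_all add: horizontal_forms_def)

lemma horizontal_zero_form [simp]: "(\<lambda>xs. 0) \<in> horizontal_forms n k"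
  by (simp add: horizontal_forms_def contract_simps)

lemma horizontal_add_closed:
  "\<alpha> \<in> horizontal_forms n k \<Longrightarrow> \<beta> \<in> horizontal_forms n k \<Longrightarrow> (\<lambda>xs. \<alpha> xs + \<beta> xs) \<in> horizontal_forms n k"
  by (simp add: horizontal_forms_def contract_simps alt_forms_sum_closed)

lemma horizontal_scale_closed:
  "\<alpha> \<in> horizontal_forms n k \<Longrightarrow> (\<lambda>xs. c * \<alpha> xs) \<in> horizontal_forms n k"
  by (simp add: horizontal_forms_def contract_simps alt_forms_scale_closed)

lemma horizontal_big_sum_closed:
  assumes "\<And>i. i \<in> I \<Longrightarrow> \<alpha> i \<in> horizontal_forms n k"
  shows "(\<lambda>xs. \<Sum>i\<in>I. \<alpha> i xs) \<in> horizontal_forms n k"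
  using assms by (induction I rule: infinite_finite_induct) (simp_all add: horizontal_add_closed)

lemma horizontal_wedge_closed:
  assumes "\<alpha> \<in> horizontal_forms n k" "\<beta> \<in> horizontal_forms n l"
  shows "wedge \<alpha> \<beta> \<in> horizontal_forms n (k + l)"
  using heis.wedge_alt [OF horizontal_formsD(1) horizontal_formsD(1), OF assms] assms
  by (simp add: horizontal_forms_def contract_wedge)

lemma horizontal_contract_closed:
  assumes "\<omega> \<in> horizontal_forms n k"
  shows "contract x \<omega> \<in> horizontal_forms n (k - 1)"
  using heis.contract_alt [OF horizontal_formsD(1) [OF assms]]
    heis.contract_swap [OF horizontal_formsD(1) [OF assms], of "heis_z n" x] horizontal_formsD(2) [OF assms]
  by (simp add: horizontal_forms_def contract_simps)

lemma coord_horizontal: "i < 2 * n \<Longrightarrow> heis_coord n i \<in> horizontal_forms n 1"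
  using heis_coord_alt [of i n] contract_z_coord [of i n] by (simp add: horizontal_forms_def)

lemma symplectic_horizontal: "heis_symplectic n \<in> horizontal_forms n 2"
  by (simp add: horizontal_forms_def heis_symplectic_alt contract_z_symplectic)

definition lefschetz :: "nat \<Rightarrow> (real vec list \<Rightarrow> real) \<Rightarrow> real vec list \<Rightarrow> real" where
  "lefschetz n = wedge (heis_symplectic n)"

text \<open>Together with the Lefschetz operator this generates a copy of \<open>sl\<^sub>2\<close> acting on horizontal forms.\<close>

definition dual_lefschetz :: "nat \<Rightarrow> (real vec list \<Rightarrow> real) \<Rightarrow> real vec list \<Rightarrow> real" where
  "dual_lefschetz n \<omega> = (\<lambda>xs. \<Sum>j<n.
     contract (unit_vec (2 * n + 1) (2 * j + 1)) (contract (unit_vec (2 * n + 1) (2 * j)) \<omega>) xs)"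

lemma lefschetz_horizontal:
  "\<omega> \<in> horizontal_forms n k \<Longrightarrow> lefschetz n \<omega> \<in> horizontal_forms n (k + 2)"
  using horizontal_wedge_closed [OF symplectic_horizontal] by (simp add: lefschetz_def add.commute)

lemma lefschetz_pow_horizontal:
  "\<omega> \<in> horizontal_forms n k \<Longrightarrow> (lefschetz n ^^ r) \<omega> \<in> horizontal_forms n (k + 2 * r)"
  by (induction r) (auto dest: lefschetz_horizontal simp: algebra_simps)

lemma lefschetz_linear:
  "lefschetz n (\<lambda>xs. \<alpha> xs + \<beta> xs) = (\<lambda>xs. lefschetz n \<alpha> xs + lefschetz n \<beta> xs)"
  "lefschetz n (\<lambda>xs. c * \<alpha> xs) = (\<lambda>xs. c * lefschetz n \<alpha> xs)"
  "lefschetz n (\<lambda>xs. 0) = (\<lambda>xs. 0)"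
  by (simp_all add: lefschetz_def wedge_add_right wedge_scale_right)

lemma lefschetz_pow_zero: "(lefschetz n ^^ r) (\<lambda>xs. 0) = (\<lambda>xs. 0)"
  by (induction r) (simp_all add: lefschetz_linear)

lemma dual_lefschetz_horizontal:
  assumes "\<omega> \<in> horizontal_forms n k"
  shows "dual_lefschetz n \<omega> \<in> horizontal_forms n (k - 2)"
proof -
  have "contract x (contract y \<omega>) \<in> horizontal_forms n (k - 2)" for x y
    using horizontal_contract_closed [OF horizontal_contract_closed [OF assms]] by (simp add: numeral_2_eq_2)
  then show ?thesis
    unfolding dual_lefschetz_def by (intro horizontal_big_sum_closed)
qed

lemma sum_even_odd: "(\<Sum>i<2 * n. f i) = (\<Sum>j<n. f (2 * j) + f (2 * j + 1))" for f :: "nat \<Rightarrow> real"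
  by (induction n) simp_all

lemma contract_symplectic_basis:
  assumes "j < n"
  shows "contract (unit_vec (2 * n + 1) (2 * j)) (heis_symplectic n) = heis_coord n (2 * j + 1)" (is ?even)
    and "contract (unit_vec (2 * n + 1) (2 * j + 1)) (heis_symplectic n) = (\<lambda>xs. - heis_coord n (2 * j) xs)"
      (is ?odd)
proof -
  let ?e = "unit_vec (2 * n + 1) :: nat \<Rightarrow> real vec"
  have unit: "unit_vec (Suc (2 * n)) i $ (2 * l) = (if 2 * l = i then 1 else 0 :: real)"
    "unit_vec (Suc (2 * n)) i $ Suc (2 * l) = (if Suc (2 * l) = i then 1 else 0 :: real)"
    if "l < n" for i l
    using that by (simp_all add: unit_vec_def)
  have "contract (?e (2 * j)) (heis_symplectic n)
      = (\<lambda>xs. \<Sum>l<n. if l = j then heis_coord n (2 * l + 1) xs else 0)"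
    by (subst contract_heis_symplectic, simp, intro ext sum.cong refl)
       (use assms in \<open>auto simp: unit simp del: index_unit_vec\<close>)
  then show ?even
    using assms by simp
  have "contract (?e (2 * j + 1)) (heis_symplectic n)
      = (\<lambda>xs. \<Sum>l<n. if l = j then - heis_coord n (2 * l) xs else 0)"
    by (subst contract_heis_symplectic, simp, intro ext sum.cong refl)
       (use assms in \<open>auto simp: unit simp del: index_unit_vec\<close>)
  then show ?odd
    using assms by simp
qed

text \<open>Pushing both contractions through \<open>\<Omega>\<close> leaves, for each pair of coordinates, the form itself minus
  the two summands of the Euler identity that belong to this pair. The sum over the \<open>n\<close> pairs is
  \<open>n - k\<close> times the form.\<close>

lemma lefschetz_commutator:
  assumes \<omega>: "\<omega> \<in> horizontal_forms n k"
  shows "dual_lefschetz n (lefschetz n \<omega>)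
    = (\<lambda>xs. lefschetz n (dual_lefschetz n \<omega>) xs + (real n - real k) * \<omega> xs)"
proof
  fix xs
  let ?e = "unit_vec (2 * n + 1) :: nat \<Rightarrow> real vec" and ?\<Omega> = "heis_symplectic n"
  let ?E = "\<lambda>i. wedge (heis_coord n i) (contract (?e i) \<omega>)"
  have step: "contract (?e (2 * j + 1)) (contract (?e (2 * j)) (wedge ?\<Omega> \<omega>)) xs
      = wedge ?\<Omega> (contract (?e (2 * j + 1)) (contract (?e (2 * j)) \<omega>)) xs + \<omega> xs - (?E (2 * j) xs + ?E (2 * j + 1) xs)"
    if j: "j < n" for j
  proof -
    have "contract (?e (2 * j + 1)) (heis_coord n (2 * j + 1)) = unit_form"
      using contract_heis_coord [of "2 * j + 1" n "?e (2 * j + 1)"] j by simp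
    moreover have "twist (heis_coord n (2 * j + 1)) = (\<lambda>xs. - heis_coord n (2 * j + 1) xs)"
      using twist_alt_form [OF heis_coord_alt [of "2 * j + 1" n]] j by simp
    ultimately show ?thesis
      by (simp add: contract_wedge contract_simps contract_symplectic_basis [OF j] wedge_uminus_left del: One_nat_def)
  qed
  have "(\<Sum>j<n. ?E (2 * j) xs + ?E (2 * j + 1) xs) = (\<Sum>i<2 * n. ?E i xs)"
    by (rule sum_even_odd [symmetric])
  \<comment> \<open>The additional summand belongs to \<open>z\<close> and vanishes since the form is horizontal.\<close>
  also have "\<dots> = (\<Sum>i<2 * n + 1. ?E i xs)"
    using horizontal_formsD(2) [OF \<omega>] by (simp add: heis_z_def)
  also have "\<dots> = real k * \<omega> xs"
    by (rule fun_cong [OF heis.euler_identity [OF horizontal_formsD(1) [OF \<omega>]]])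
  finally have euler: "(\<Sum>j<n. ?E (2 * j) xs + ?E (2 * j + 1) xs) = real k * \<omega> xs" .
  have "dual_lefschetz n (lefschetz n \<omega>) xs
      = (\<Sum>j<n. wedge ?\<Omega> (contract (?e (2 * j + 1)) (contract (?e (2 * j)) \<omega>)) xs + \<omega> xs
          - (?E (2 * j) xs + ?E (2 * j + 1) xs))"
    unfolding dual_lefschetz_def lefschetz_def by (rule sum.cong [OF refl]) (rule step, simp)
  also have "\<dots> = lefschetz n (dual_lefschetz n \<omega>) xs + real n * \<omega> xs - real k * \<omega> xs"
    unfolding dual_lefschetz_def lefschetz_def
    by (simp only: sum_subtractf euler) (simp add: sum.distrib wedge_sum_right)
  finally show "dual_lefschetz n (lefschetz n \<omega>) xs
      = lefschetz n (dual_lefschetz n \<omega>) xs + (real n - real k) * \<omega> xs"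
    by (simp add: algebra_simps)
qed

text \<open>The usual consequence of an \<open>sl\<^sub>2\<close> commutator. For \<open>r = 0\<close> the last summand has coefficient zero, so
  the truncated exponent \<open>r - 1\<close> does no harm.\<close>

lemma dual_lefschetz_pow:
  assumes \<omega>: "\<omega> \<in> horizontal_forms n k"
  shows "dual_lefschetz n ((lefschetz n ^^ r) \<omega>)
    = (\<lambda>xs. (lefschetz n ^^ r) (dual_lefschetz n \<omega>) xs
        + real r * (real n - real k - real r + 1) * (lefschetz n ^^ (r - 1)) \<omega> xs)"
proof (induction r)
  case (Suc r)
  let ?L = "lefschetz n" and ?\<Lambda> = "dual_lefschetz n"
  have L: "real r * ?L ((?L ^^ (r - 1)) \<omega>) xs = real r * (?L ^^ r) \<omega> xs" for xs
    by (cases r) simp_all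
  have "?\<Lambda> ((?L ^^ Suc r) \<omega>)
      = (\<lambda>xs. ?L (?\<Lambda> ((?L ^^ r) \<omega>)) xs + (real n - real (k + 2 * r)) * (?L ^^ r) \<omega> xs)"
    using lefschetz_commutator [OF lefschetz_pow_horizontal [OF \<omega>]] by simp
  also have "\<dots> = (\<lambda>xs. (?L ^^ Suc r) (?\<Lambda> \<omega>) xs
      + (real n - real k - real r + 1) * (real r * ?L ((?L ^^ (r - 1)) \<omega>) xs)
      + (real n - real (k + 2 * r)) * (?L ^^ r) \<omega> xs)"
    unfolding Suc.IH lefschetz_linear by (simp add: algebra_simps)
  also have "\<dots> = (\<lambda>xs. (?L ^^ Suc r) (?\<Lambda> \<omega>) xs
        + real (Suc r) * (real n - real k - real (Suc r) + 1) * (?L ^^ (Suc r - 1)) \<omega> xs)"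
    unfolding L by (rule ext) (simp add: algebra_simps)
  finally show ?case .
qed simp

text \<open>If \<open>L\<^sup>r\<^sup>+\<^sup>1 \<omega> = 0\<close>, the formula for \<open>\<Lambda> L\<^sup>r\<^sup>+\<^sup>1\<close> shows that \<open>L\<close> to the power \<open>r + 2\<close> kills
  \<open>\<Lambda> \<omega>\<close>, which has smaller degree and hence vanishes by induction. What remains of the formula is a
  non-zero multiple of \<open>L\<^sup>r \<omega>\<close>, so the exponent can be lowered. Proving the statement for all powers
  at once is what makes the induction on the degree possible: the exponent grows by one while the
  degree drops by two.\<close>

lemma lefschetz_pow_injective:
  assumes "\<omega> \<in> horizontal_forms n k" "(lefschetz n ^^ r) \<omega> = (\<lambda>xs. 0)" "k + r \<le> n"
  shows "\<omega> = (\<lambda>xs. 0)"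
  using assms
proof (induction k arbitrary: \<omega> r rule: less_induct)
  case (less k)
  let ?L = "lefschetz n" and ?\<Lambda> = "dual_lefschetz n"
  from less.prems(2,3) show ?case
  proof (induction r)
    case (Suc r)
    define c where "c = real (Suc r) * (real n - real k - real (Suc r) + 1)"
    have c: "c \<noteq> 0"
      using Suc.prems(2) by (auto simp: c_def)
    have "?\<Lambda> ((?L ^^ Suc r) \<omega>) = (\<lambda>xs. 0)"
      unfolding Suc.prems(1) by (simp add: dual_lefschetz_def contract_simps)
    then have rel: "(?L ^^ Suc r) (?\<Lambda> \<omega>) xs + c * (?L ^^ r) \<omega> xs = 0" for xs
      using dual_lefschetz_pow [OF less.prems(1), of "Suc r"] by (simp add: fun_eq_iff c_def)
    have "?\<Lambda> \<omega> = (\<lambda>xs. 0)"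
    proof (cases "k < 2")
      case True
      then have "contract y (contract x \<omega>) = (\<lambda>xs. 0)" for x y
        using heis.contract_alt [OF horizontal_formsD(1) [OF less.prems(1)], of x]
          contract_degree_zero [of _ "heisenberg n"] by fastforce
      then show ?thesis
        by (simp add: dual_lefschetz_def)
    next
      case False
      have "(?L ^^ Suc r) (?\<Lambda> \<omega>) = (\<lambda>xs. - c * (?L ^^ r) \<omega> xs)"
        using rel by (auto simp: fun_eq_iff eq_neg_iff_add_eq_0)
      then have "(?L ^^ Suc (Suc r)) (?\<Lambda> \<omega>) = (\<lambda>xs. - c * (?L ^^ Suc r) \<omega> xs)"
        using lefschetz_linear(2) [of n "- c"] by simp
      then have "(?L ^^ Suc (Suc r)) (?\<Lambda> \<omega>) = (\<lambda>xs. 0)"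
        unfolding Suc.prems(1) by simp
      then show ?thesis
        using False Suc.prems(2) less.IH [of "k - 2" "?\<Lambda> \<omega>" "Suc (Suc r)"]
          dual_lefschetz_horizontal [OF less.prems(1)]
        by auto
    qed
    then have "c * (?L ^^ r) \<omega> xs = 0" for xs
      using rel [of xs] lefschetz_pow_zero [where n = n and r = "Suc r"] by simp
    then have "(?L ^^ r) \<omega> = (\<lambda>xs. 0)"
      using c by (simp add: fun_eq_iff)
    then show ?case
      using Suc by simp
  qed simp
qed

corollary lefschetz_injective:
  assumes "\<omega> \<in> horizontal_forms n k" "wedge (heis_symplectic n) \<omega> = (\<lambda>xs. 0)" "k < n"
  shows "\<omega> = (\<lambda>xs. 0)"
  using lefschetz_pow_injective [OF assms(1), of 1] assms by (simp add: lefschetz_def)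

text \<open>Once all horizontal forms of some degree are multiples of \<open>\<Omega>\<close>, so are those of all higher degrees,
  as the Euler identity writes them as sums of products of coordinates with forms of one degree
  less.\<close>

lemma horizontal_above_middle_exact:
  assumes "horizontal_forms n (k + 2) \<subseteq> wedge (heis_symplectic n) ` horizontal_forms n k"
  shows "horizontal_forms n (k + r + 2) \<subseteq> wedge (heis_symplectic n) ` horizontal_forms n (k + r)"
proof (induction r)
  case 0
  then show ?case using assms by simp
next
  case (Suc r)
  let ?e = "unit_vec (2 * n + 1) :: nat \<Rightarrow> real vec" and ?\<Omega> = "heis_symplectic n"
  show ?case
  proof
    fix \<omega> assume \<omega>: "\<omega> \<in> horizontal_forms n (k + Suc r + 2)"
    have "\<exists>\<eta>\<in>horizontal_forms n (k + r). contract (?e i) \<omega> = wedge ?\<Omega> \<eta>" for i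
      using horizontal_contract_closed [OF \<omega>, of "?e i"] Suc.IH by auto
    then obtain \<eta> where \<eta>: "\<And>i. \<eta> i \<in> horizontal_forms n (k + r)"
      "\<And>i. contract (?e i) \<omega> = wedge ?\<Omega> (\<eta> i)"
      by metis
    \<comment> \<open>The Euler identity for \<open>\<omega>\<close> with the factor \<open>\<Omega>\<close> cancelled.\<close>
    define \<zeta> where "\<zeta> = (\<lambda>xs. (1 / real (k + Suc r + 2)) * (\<Sum>i<2 * n. wedge (heis_coord n i) (\<eta> i) xs))"
    have \<zeta>: "\<zeta> \<in> horizontal_forms n (k + Suc r)"
      unfolding \<zeta>_def using horizontal_wedge_closed [OF coord_horizontal \<eta>(1)]
      by (intro horizontal_scale_closed horizontal_big_sum_closed) auto
    have "real (k + Suc r + 2) * \<omega> xs = (\<Sum>i<2 * n. wedge (heis_coord n i) (contract (?e i) \<omega>) xs)" for xs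
      using fun_cong [OF heis.euler_identity [OF horizontal_formsD(1) [OF \<omega>]], of xs] horizontal_formsD(2) [OF \<omega>]
      by (simp add: heis_z_def)
    also have "(\<Sum>i<2 * n. wedge (heis_coord n i) (contract (?e i) \<omega>) xs)
        = (\<Sum>i<2 * n. wedge ?\<Omega> (wedge (heis_coord n i) (\<eta> i)) xs)" for xs
      by (intro sum.cong refl) (subst \<eta>(2), subst symplectic_central [OF heis_coord_alt], auto)
    finally have "wedge ?\<Omega> \<zeta> = \<omega>"
      unfolding \<zeta>_def wedge_scale_right wedge_sum_right by (simp add: fun_eq_iff field_simps)
    then show "\<omega> \<in> wedge ?\<Omega> ` horizontal_forms n (k + Suc r)"
      using \<zeta> by blast
  qed
qed

section \<open>The dimension of the space of horizontal forms\<close>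

text \<open>Coordinate functionals which separate points and admit a dual family identify the space with the
  functions on their index set.\<close>

lemma dim_by_coordinates:
  fixes V :: "(real, 'v, 'm) module_scheme" and c :: "'v \<Rightarrow> 'i \<Rightarrow> real"
  assumes vs: "vectorspace class_ring V" and finX: "finite X"
    and add: "\<And>v w i. \<lbrakk>v \<in> carrier V; w \<in> carrier V; i \<in> X\<rbrakk> \<Longrightarrow> c (v \<oplus>\<^bsub>V\<^esub> w) i = c v i + c w i"
    and smult: "\<And>a v i. \<lbrakk>v \<in> carrier V; i \<in> X\<rbrakk> \<Longrightarrow> c (a \<odot>\<^bsub>V\<^esub> v) i = a * c v i"
    and inj: "\<And>v. \<lbrakk>v \<in> carrier V; \<And>i. i \<in> X \<Longrightarrow> c v i = 0\<rbrakk> \<Longrightarrow> v = \<zero>\<^bsub>V\<^esub>"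
    and b: "\<And>i. i \<in> X \<Longrightarrow> b i \<in> carrier V"
    and dual: "\<And>i j. \<lbrakk>i \<in> X; j \<in> X\<rbrakk> \<Longrightarrow> c (b i) j = (if i = j then 1 else 0)"
  shows "vectorspace.fin_dim class_ring V" "vectorspace.dim class_ring V = card X"
proof -
  interpret vectorspace class_ring V by (rule vs)
  have zero: "c \<zero>\<^bsub>V\<^esub> i = 0" if "i \<in> X" for i
    using smult [of "\<zero>\<^bsub>V\<^esub>" i 0] that by simp
  have c_lincomb: "c (lincomb a B) i = (\<Sum>v\<in>B. a v * c v i)" if "finite B" "B \<subseteq> carrier V" "i \<in> X" for a B i
    using that
  proof (induction B)
    case empty
    then show ?case by (simp add: lincomb_def zero)
  next
    case (insert v B)
    have "lincomb a (insert v B) = a v \<odot>\<^bsub>V\<^esub> v \<oplus>\<^bsub>V\<^esub> lincomb a B"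
      unfolding lincomb_def using insert by (intro M.finsum_insert) auto
    moreover have "lincomb a B \<in> carrier V"
      using insert by (intro lincomb_closed) auto
    ultimately show ?case
      using insert by (simp add: add smult)
  qed
  let ?A = "b ` X"
  have inj_b: "inj_on b X"
    using dual by (metis inj_onI zero_neq_one)
  have A: "finite ?A" "?A \<subseteq> carrier V"
    using finX b by auto
  have coeff: "c (lincomb a ?A) i = a (b i)" if i: "i \<in> X" for a i
  proof -
    have "c (lincomb a ?A) i = (\<Sum>j\<in>X. if j = i then a (b j) else 0)"
      unfolding c_lincomb [OF A i] sum.reindex [OF inj_b] comp_def
      by (intro sum.cong refl) (simp add: dual i)
    then show ?thesis
      using i finX by simp
  qed
  have "v \<in> span ?A" if v: "v \<in> carrier V" for v
  proof -
    define a where "a u = c v (inv_into X b u)" for u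
    have l: "lincomb a ?A \<in> carrier V"
      using A by (intro lincomb_closed) auto
    \<comment> \<open>The difference has vanishing coordinates.\<close>
    have "v \<oplus>\<^bsub>V\<^esub> (-1) \<odot>\<^bsub>V\<^esub> lincomb a ?A = \<zero>\<^bsub>V\<^esub>"
      by (rule inj) (use v l inj_b in \<open>auto simp: add smult coeff a_def\<close>)
    then have "v = lincomb a ?A"
      using v l smult_minus_1 [of "lincomb a ?A"]
      by (simp add: class_ring_simps M.minus_equality M.add.inv_solve_right' flip: M.minus_unique)
    then show ?thesis
      unfolding span_def by (intro CollectI exI [of _ a] exI [of _ ?A] conjI) (simp_all add: A(1))
  qed
  then have gen: "gen_set ?A"
    using span_is_subset2 [OF A(2)] by blast
  have "lin_indpt ?A"
  proof (rule finite_lin_indpt2 [OF A])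
    fix a assume "lincomb a ?A = \<zero>\<^bsub>V\<^esub>"
    then have "a (b i) = 0" if "i \<in> X" for i
      using coeff [OF that, of a] zero [OF that] by simp
    then show "\<forall>v\<in>?A. a v = \<zero>\<^bsub>class_ring\<^esub>"
      by simp
  qed
  then have "basis ?A"
    using gen A unfolding basis_def by blast
  then show "dim = card X"
    using dim_basis [OF A(1)] by (simp add: card_image inj_b)
  show "fin_dim"
    using A gen unfolding fin_dim_def by blast
qed

abbreviation horizontal_space :: "nat \<Rightarrow> nat \<Rightarrow> (real, real vec list \<Rightarrow> real) module" where
  "horizontal_space n k \<equiv> cochains (heisenberg n) k\<lparr>carrier := horizontal_forms n k\<rparr>"

lemma horizontal_subspace: "subspace class_ring (horizontal_forms n k) (cochains (heisenberg n) k)"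
proof -
  interpret vectorspace class_ring "cochains (heisenberg n) k" by (rule cochains_vectorspace)
  show ?thesis
    by (rule subspace.intro, rule cochains_vectorspace, unfold_locales)
       (auto simp: horizontal_add_closed horizontal_scale_closed dest: horizontal_formsD)
qed

lemma horizontal_vectorspace: "vectorspace class_ring (horizontal_space n k)"
  by (rule vectorspace.subspace_is_vs [OF cochains_vectorspace horizontal_subspace])

lemma sorted_list_of_set_insert_less:
  assumes "finite S" "\<And>a. a \<in> S \<Longrightarrow> b < a"
  shows "sorted_list_of_set (insert b S) = b # sorted_list_of_set S"
proof -
  have "b \<notin> S"
    using assms(2) by blast
  then show ?thesis
    using assms by (simp add: sorted_list_of_set_insert_remove insort_is_Cons less_imp_le)
qed

text \<open>A form is determined by its values on increasing lists of basis vectors. The induction runs over a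
  set \<open>A\<close> of indices outside of which all contractions vanish: if \<open>b\<close> is smaller than all elements of
  \<open>A\<close>, the contraction of the form with \<open>e\<^sub>b\<close> satisfies the hypothesis for \<open>A\<close>, as \<open>b\<close> can be put in
  front of any increasing list from \<open>A\<close>. Hence it vanishes, and \<open>b\<close> may be dropped.\<close>

lemma horizontal_zeroI:
  assumes \<omega>: "\<omega> \<in> horizontal_forms n k"
    and coords: "\<And>S. S \<subseteq> {..<2 * n} \<Longrightarrow> \<omega> (map (unit_vec (2 * n + 1)) (sorted_list_of_set S)) = 0"
  shows "\<omega> = (\<lambda>xs. 0)"
proof -
  let ?e = "unit_vec (2 * n + 1) :: nat \<Rightarrow> real vec"
  have "\<omega> = (\<lambda>xs. 0)"
    if "finite A" "\<omega> \<in> horizontal_forms n k" "\<And>j. j < 2 * n \<Longrightarrow> j \<notin> A \<Longrightarrow> contract (?e j) \<omega> = (\<lambda>xs. 0)"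
      "\<And>S. S \<subseteq> A \<Longrightarrow> \<omega> (map ?e (sorted_list_of_set S)) = 0" for A \<omega> k
    using that
  proof (induction A arbitrary: \<omega> k rule: finite_linorder_min_induct)
    case empty
    have "contract (?e j) \<omega> = (\<lambda>xs. 0)" if "j < 2 * n + 1" for j
      using that empty.prems(2) [of j] horizontal_formsD(2) [OF empty.prems(1)]
      by (cases "j = 2 * n") (auto simp: heis_z_def)
    then have "\<omega> (x # xs) = 0" if "x \<in> carrier (heisenberg n)" for x xs
      using heis.expand_first [OF horizontal_formsD(1) [OF empty.prems(1)] that, of xs]
      by (simp add: contract_def fun_eq_iff del: heisenberg_simps)
    moreover have "\<omega> (x # xs) = 0" if "x \<notin> carrier (heisenberg n)" for x xs
      using alt_forms_support [OF horizontal_formsD(1) [OF empty.prems(1)], of "x # xs"] that by simp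
    moreover have "\<omega> [] = 0"
      using empty.prems(3) [of "{}"] by simp
    ultimately show ?case
      by (metis neq_Nil_conv)
  next
    case (insert b A)
    note alt = horizontal_formsD(1) [OF insert.prems(1)]
    have "contract (?e b) \<omega> = (\<lambda>xs. 0)"
    proof (rule insert.IH [OF horizontal_contract_closed [OF insert.prems(1)]])
      fix j assume j: "j < 2 * n" "j \<notin> A"
      show "contract (?e j) (contract (?e b) \<omega>) = (\<lambda>xs. 0)"
      proof (cases "j = b")
        case True
        then show ?thesis by (simp add: contract_contract_same [OF alt])
      next
        case False
        then show ?thesis
          using heis.contract_swap [OF alt, of "?e j" "?e b"] insert.prems(2) [of j] j
          by (simp add: contract_simps)
      qed
    next
      fix S assume S: "S \<subseteq> A"
      then have "sorted_list_of_set (insert b S) = b # sorted_list_of_set S"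
        using insert.hyps finite_subset by (intro sorted_list_of_set_insert_less) auto
      moreover have "\<omega> (map ?e (sorted_list_of_set (insert b S))) = 0"
        using S by (intro insert.prems(3)) auto
      ultimately show "contract (?e b) \<omega> (map ?e (sorted_list_of_set S)) = 0"
        unfolding contract_def by (simp only: list.map)
    qed
    then show ?case
      using insert.prems by (intro insert.IH [OF insert.prems(1)]) auto
  qed
  from this [of "{..<2 * n}", OF _ \<omega>] coords show ?thesis
    by simp
qed

primrec basis_form :: "nat \<Rightarrow> nat list \<Rightarrow> real vec list \<Rightarrow> real" where
  "basis_form n [] = unit_form"
| "basis_form n (i # is) = wedge (heis_coord n i) (basis_form n is)"

lemma basis_form_horizontal: "set is \<subseteq> {..<2 * n} \<Longrightarrow> basis_form n is \<in> horizontal_forms n (length is)"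
proof (induction "is")
  case Nil
  then show ?case by (simp add: horizontal_forms_def unit_form_alt)
next
  case (Cons i "is")
  then show ?case
    using horizontal_wedge_closed [OF coord_horizontal, of i n "basis_form n is" "length is"] by simp
qed

lemma contract_basis_form:
  assumes "j \<notin> set is" "set is \<subseteq> {..<2 * n}" "j < 2 * n"
  shows "contract (unit_vec (2 * n + 1) j) (basis_form n is) = (\<lambda>xs. 0)"
  using assms(1,2)
proof (induction "is")
  case (Cons i "is")
  have "contract (unit_vec (2 * n + 1) j) (heis_coord n i) = (\<lambda>xs. 0)"
    using contract_heis_coord [of i n "unit_vec (2 * n + 1) j"] Cons.prems assms(3)
    by (auto simp: unit_vec_def)
  then show ?case
    using Cons by (simp add: contract_wedge)
qed simp

lemma wedge_vanishing_one_form: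
  assumes \<phi>: "\<phi> \<in> alt_forms V 1" and "\<And>x. x \<in> set xs \<Longrightarrow> \<phi> [x] = 0"
  shows "wedge \<phi> \<beta> xs = 0"
  using assms(2)
proof (induction xs arbitrary: \<beta>)
  case Nil
  then show ?case using alt_forms_support [OF \<phi>, of "[]"] by simp
next
  case (Cons x xs)
  then show ?case
    by (simp add: wedge_Cons contract_one_form [OF \<phi>] twist_alt_form [OF \<phi>] wedge_uminus_left)
qed

text \<open>Feeding the first argument \<open>e\<^sub>j\<close> to the first coordinate \<open>i\<close> gives the Kronecker symbol times the
  same problem for the tails. Feeding it to the other coordinates gives zero: either \<open>j\<close> is not among
  their indices, or \<open>j\<close> exceeds \<open>i\<close>, and then the coordinate \<open>i\<close> vanishes on all remaining arguments,
  whose indices exceed \<open>j\<close>.\<close>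

lemma basis_form_dual:
  assumes "sorted_wrt (<) is" "sorted_wrt (<) js" "set is \<subseteq> {..<2 * n}" "set js \<subseteq> {..<2 * n}"
  shows "basis_form n is (map (unit_vec (2 * n + 1)) js) = (if is = js then 1 else 0)"
  using assms
proof (induction "is" arbitrary: js)
  case Nil
  then show ?case by (simp add: unit_form_def)
next
  case (Cons i "is")
  let ?e = "unit_vec (2 * n + 1) :: nat \<Rightarrow> real vec"
  have \<phi>: "heis_coord n i \<in> alt_forms (heisenberg n) 1"
    using Cons.prems by (intro heis_coord_alt) auto
  have coord: "heis_coord n i [?e j] = (if i = j then 1 else 0)" if "j < 2 * n" for j
    using that Cons.prems heis_coord_apply [of "?e j" n i] by (auto simp: unit_vec_def)
  show ?case
  proof (cases js)
    case Nil
    then show ?thesis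
      using alt_forms_support [OF \<phi>, of "[]"] by simp
  next
    case (Cons j js')
    have j: "j < 2 * n" "set js' \<subseteq> {..<2 * n}" "\<And>l. l \<in> set js' \<Longrightarrow> j < l"
      using Cons.prems Cons by auto
    have "wedge (heis_coord n i) (contract (?e j) (basis_form n is)) (map ?e js') = 0"
    proof (cases "j \<in> set is")
      case True
      then have "i \<notin> set js'"
        using Cons.prems(1) j(3) by force
      then show ?thesis
        using coord j(2) by (intro wedge_vanishing_one_form [OF \<phi>]) auto
    next
      case False
      then show ?thesis
        using contract_basis_form [of j "is" n] Cons.prems j by simp
    qed
    then have "basis_form n (i # is) (map ?e js) = (if i = j then 1 else 0) * basis_form n is (map ?e js')"
      using coord [OF j(1)]
      by (simp add: Cons wedge_Cons contract_one_form [OF \<phi>] twist_alt_form [OF \<phi>] wedge_uminus_left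
          wedge_scale_left)
    then show ?thesis
      using Cons.IH [of js'] Cons.prems Cons by simp
  qed
qed

text \<open>Coordinates are the values at the increasing lists enumerating the \<open>k\<close>-subsets of the indices of
  the \<open>y\<^sub>i\<close>.\<close>

lemma horizontal_dim:
  "vectorspace.fin_dim class_ring (horizontal_space n k)"
  "vectorspace.dim class_ring (horizontal_space n k) = (2 * n) choose k"
proof -
  let ?X = "{S. S \<subseteq> {..<2 * n} \<and> card S = k}"
  let ?c = "\<lambda>\<omega> S. \<omega> (map (unit_vec (2 * n + 1)) (sorted_list_of_set S)) :: real"
  let ?b = "\<lambda>S. basis_form n (sorted_list_of_set S)"
  have fin: "finite S" if "S \<subseteq> {..<2 * n}" for S
    using that finite_subset by blast
  have X: "finite ?X"
    by (rule finite_subset [of _ "Pow {..<2 * n}"]) auto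
  let ?V = "horizontal_space n k"
  have add: "?c (\<alpha> \<oplus>\<^bsub>?V\<^esub> \<beta>) S = ?c \<alpha> S + ?c \<beta> S" for \<alpha> \<beta> S
    by simp
  have smult: "?c (a \<odot>\<^bsub>?V\<^esub> \<alpha>) S = a * ?c \<alpha> S" for a \<alpha> S
    by simp
  have zero: "\<omega> = \<zero>\<^bsub>?V\<^esub>" if "\<omega> \<in> carrier ?V" and "\<And>S. S \<in> ?X \<Longrightarrow> ?c \<omega> S = 0" for \<omega>
  proof -
    have \<omega>: "\<omega> \<in> horizontal_forms n k"
      using that by simp
    have "\<omega> = (\<lambda>xs. 0)"
    proof (rule horizontal_zeroI [OF \<omega>])
      fix S :: "nat set" assume S: "S \<subseteq> {..<2 * n}"
      show "?c \<omega> S = 0"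
      proof (cases "card S = k")
        case False
        then show ?thesis
          using alt_forms_support [OF horizontal_formsD(1) [OF \<omega>]] S by simp
      qed (use that S in auto)
    qed
    then show ?thesis
      by simp
  qed
  have b: "?b S \<in> carrier ?V" if "S \<in> ?X" for S
    using basis_form_horizontal [of "sorted_list_of_set S" n] that fin by auto
  have dual: "?c (?b S) T = (if S = T then 1 else 0)" if "S \<in> ?X" "T \<in> ?X" for S T
  proof -
    have "sorted_list_of_set S = sorted_list_of_set T \<longleftrightarrow> S = T"
      using that fin by (metis (no_types, lifting) mem_Collect_eq set_sorted_list_of_set)
    then show ?thesis
      using that fin by (subst basis_form_dual) auto
  qed
  note dims = dim_by_coordinates [OF horizontal_vectorspace X, where c = ?c and b = ?b, OF add smult zero b dual]
  show "vectorspace.fin_dim class_ring ?V"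
    by (rule dims(1))
  show "vectorspace.dim class_ring ?V = (2 * n) choose k"
    using dims(2) n_subsets [of "{..<2 * n}" k] by simp
qed

section \<open>Horizontal forms come from the abelianization\<close>

text \<open>The bracket of the first pair of basis vectors is \<open>z\<close>; this is where \<open>n \<ge> 1\<close> enters.\<close>

lemma heis_derived_algebra:
  assumes "n \<ge> 1"
  shows "derived_algebra (heisenberg n) = range (\<lambda>c. c \<cdot>\<^sub>v heis_z n)"
proof -
  let ?g = "heisenberg n" and ?z = "heis_z n"
  let ?S = "{bracket ?g x y |x y. x \<in> carrier ?g \<and> y \<in> carrier ?g}"
  interpret vectorspace class_ring ?g by (rule heisenberg_vectorspace)
  have z: "?z \<in> carrier_vec (2 * n + 1)"
    by (simp add: heis_z_def)
  have "submodule class_ring (range (\<lambda>c. c \<cdot>\<^sub>v ?z)) ?g"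
  proof
    show "range (\<lambda>c. c \<cdot>\<^sub>v ?z) \<subseteq> carrier ?g"
      using z by auto
    show "\<zero>\<^bsub>?g\<^esub> \<in> range (\<lambda>c. c \<cdot>\<^sub>v ?z)"
      using z by (auto intro!: image_eqI [of _ _ 0])
  qed (use z in \<open>auto simp: smult_smult_assoc simp flip: add_smult_distrib_vec\<close>)
  moreover have "?S \<subseteq> range (\<lambda>c. c \<cdot>\<^sub>v ?z)"
    using heis_bracket_symplectic by blast
  ultimately have "span ?S \<subseteq> range (\<lambda>c. c \<cdot>\<^sub>v ?z)"
    by (intro span_is_subset)
  moreover have "c \<cdot>\<^sub>v ?z \<in> span ?S" for c
  proof -
    have S: "?S \<subseteq> carrier ?g"
      using heis_bracket_symplectic z by auto
    have "bracket ?g (heis_y n 1) (heis_y n 2) = ?z"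
      using heisenberg_bracket_basis [of 1 n] assms by simp
    moreover have "heis_y n 1 \<in> carrier ?g" "heis_y n 2 \<in> carrier ?g"
      by (simp_all add: heis_y_def)
    ultimately have "?z \<in> ?S"
      unfolding mem_Collect_eq by metis
    then have "?z \<in> span ?S"
      using in_own_span [OF S] by blast
    then show ?thesis
      using submodule.smult_closed [OF span_is_submodule [OF S], of c ?z] by simp
  qed
  ultimately show ?thesis
    unfolding derived_algebra_def by auto
qed

context
  fixes n :: nat
  assumes n: "n \<ge> 1"
begin


private abbreviation (input) g where "g \<equiv> heisenberg n"
private abbreviation (input) ab where "ab \<equiv> abelianization g"
private abbreviation (input) proj where "proj \<equiv> abelianization_map g"
private abbreviation (input) z where "z \<equiv> heis_z n"

private lemma z: "z \<in> carrier_vec (2 * n + 1)"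
  by (simp add: heis_z_def)

lemma mem_proj: "v \<in> proj x \<longleftrightarrow> (\<exists>c. v = c \<cdot>\<^sub>v z + x)"
  by (auto simp: abelianization_map_def heis_derived_algebra [OF n] a_r_coset_def r_coset_def)

lemma proj_shift:
  assumes y: "y \<in> carrier g"
  shows "proj (c \<cdot>\<^sub>v z + y) = proj y"
proof (intro equalityI subsetI)
  fix v assume "v \<in> proj (c \<cdot>\<^sub>v z + y)"
  then obtain d where "v = d \<cdot>\<^sub>v z + (c \<cdot>\<^sub>v z + y)"
    unfolding mem_proj ..
  then have "v = (d + c) \<cdot>\<^sub>v z + y"
    using y z by (intro eq_vecI) (auto simp: algebra_simps)
  then show "v \<in> proj y"
    unfolding mem_proj ..
next
  fix v assume "v \<in> proj y"
  then obtain d where "v = d \<cdot>\<^sub>v z + y"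
    unfolding mem_proj ..
  then have "v = (d - c) \<cdot>\<^sub>v z + (c \<cdot>\<^sub>v z + y)"
    using y z by (intro eq_vecI) (auto simp: algebra_simps)
  then show "v \<in> proj (c \<cdot>\<^sub>v z + y)"
    unfolding mem_proj ..
qed

lemma proj_self: "x \<in> carrier g \<Longrightarrow> x \<in> proj x"
  unfolding mem_proj using z by (intro exI [of _ 0]) auto

lemma proj_eq_iff:
  assumes "x \<in> carrier g" "y \<in> carrier g"
  shows "proj x = proj y \<longleftrightarrow> (\<exists>c. x = c \<cdot>\<^sub>v z + y)"
  using proj_self [OF assms(1)] proj_shift [OF assms(2)] mem_proj by metis

lemma derived_eq_proj: "derived_algebra g = proj (c \<cdot>\<^sub>v z)"
proof (intro equalityI subsetI)
  fix v assume "v \<in> derived_algebra g"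
  then obtain d where "v = d \<cdot>\<^sub>v z"
    unfolding heis_derived_algebra [OF n] by auto
  then have "v = (d - c) \<cdot>\<^sub>v z + c \<cdot>\<^sub>v z"
    using z by (intro eq_vecI) (auto simp: algebra_simps)
  then show "v \<in> proj (c \<cdot>\<^sub>v z)"
    unfolding mem_proj ..
next
  fix v assume "v \<in> proj (c \<cdot>\<^sub>v z)"
  then obtain d where "v = d \<cdot>\<^sub>v z + c \<cdot>\<^sub>v z"
    unfolding mem_proj ..
  then have "v = (d + c) \<cdot>\<^sub>v z"
    using z by (intro eq_vecI) (auto simp: algebra_simps)
  then show "v \<in> derived_algebra g"
    unfolding heis_derived_algebra [OF n] by blast
qed

lemma ab_carrier: "carrier ab = proj ` carrier g"
  by (auto simp: abelianization_def quotient_lie_def A_RCOSETS_def' abelianization_map_def)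

lemma ab_add:
  assumes "x \<in> carrier g" "y \<in> carrier g"
  shows "proj x \<oplus>\<^bsub>ab\<^esub> proj y = proj (x + y)"
proof -
  have "proj x \<oplus>\<^bsub>ab\<^esub> proj y = {v + w |v w. v \<in> proj x \<and> w \<in> proj y}"
    by (auto simp: abelianization_def quotient_lie_def set_add_def')
  also have "\<dots> = proj (x + y)"
  proof (intro equalityI subsetI)
    fix u assume "u \<in> {v + w |v w. v \<in> proj x \<and> w \<in> proj y}"
    then obtain c d where "u = (c \<cdot>\<^sub>v z + x) + (d \<cdot>\<^sub>v z + y)"
      by (auto simp: mem_proj)
    then have "u = (c + d) \<cdot>\<^sub>v z + (x + y)"
      using assms z by (intro eq_vecI) (auto simp: algebra_simps)
    then show "u \<in> proj (x + y)"
      unfolding mem_proj ..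
  next
    fix u assume "u \<in> proj (x + y)"
    then obtain c where "u = c \<cdot>\<^sub>v z + (x + y)"
      unfolding mem_proj ..
    then have "u = (c \<cdot>\<^sub>v z + x) + y"
      using assms z by (intro eq_vecI) auto
    moreover have "c \<cdot>\<^sub>v z + x \<in> proj x"
      unfolding mem_proj by blast
    ultimately show "u \<in> {v + w |v w. v \<in> proj x \<and> w \<in> proj y}"
      using proj_self [OF assms(2)] by blast
  qed
  finally show ?thesis .
qed

lemma ab_smult:
  assumes "x \<in> carrier g"
  shows "a \<odot>\<^bsub>ab\<^esub> proj x = proj (a \<cdot>\<^sub>v x)"
proof -
  have "proj (a \<cdot>\<^sub>v v) = proj (a \<cdot>\<^sub>v x)" if v: "v \<in> proj x" for v
  proof -
    from v obtain c where "v = c \<cdot>\<^sub>v z + x"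
      unfolding mem_proj ..
    then have "a \<cdot>\<^sub>v v = (a * c) \<cdot>\<^sub>v z + a \<cdot>\<^sub>v x"
      using assms z by (intro eq_vecI) (auto simp: algebra_simps)
    then show ?thesis
      using proj_shift assms by simp
  qed
  moreover have "a \<odot>\<^bsub>ab\<^esub> proj x = (\<Union>v\<in>proj x. proj (a \<cdot>\<^sub>v v))"
    by (simp add: abelianization_def quotient_lie_def abelianization_map_def)
  ultimately show ?thesis
    using proj_self [OF assms] by blast
qed

lemma ab_bracket:
  assumes "C \<in> carrier ab" "D \<in> carrier ab"
  shows "bracket ab C D = proj z"
proof -
  have mem: "v \<in> carrier g" if "v \<in> C \<or> v \<in> D" for v
    using that assms z by (auto simp: ab_carrier mem_proj)
  have multiple: "proj (c \<cdot>\<^sub>v z) = proj z" for c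
    using derived_eq_proj [of c] derived_eq_proj [of 1] by simp
  have "derived_algebra g +>\<^bsub>g\<^esub> bracket g v w = proj z" if "v \<in> C" "w \<in> D" for v w
  proof -
    have "bracket g v w = heis_symplectic n [v, w] \<cdot>\<^sub>v z"
      using that mem by (intro heis_bracket_symplectic) auto
    then show ?thesis
      using multiple unfolding abelianization_map_def by metis
  qed
  moreover have "bracket ab C D = (\<Union>v\<in>C. \<Union>w\<in>D. derived_algebra g +>\<^bsub>g\<^esub> bracket g v w)"
    unfolding abelianization_def quotient_lie_def by simp
  moreover have "C \<noteq> {}" "D \<noteq> {}"
    using assms proj_self by (auto simp: ab_carrier)
  ultimately show ?thesis
    by auto
qed

interpretation ab: linear_space ab
proof
  show "C \<oplus>\<^bsub>ab\<^esub> D \<in> carrier ab" if "C \<in> carrier ab" "D \<in> carrier ab" for C D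
    using that unfolding ab_carrier by (auto simp: ab_add)
  show "a \<odot>\<^bsub>ab\<^esub> C \<in> carrier ab" if "C \<in> carrier ab" for a C
    using that unfolding ab_carrier by (auto simp: ab_smult)
qed

lemma proj_mem: "x \<in> carrier g \<Longrightarrow> proj x \<in> carrier ab"
  by (simp add: ab_carrier)

lemma ab_form_z:
  assumes \<omega>: "\<omega> \<in> alt_forms ab k"
  shows "\<omega> (ps @ proj z # qs) = 0"
proof -
  have "proj z = 0 \<odot>\<^bsub>ab\<^esub> proj z"
    using derived_eq_proj [of 1] derived_eq_proj [of 0] z by (simp add: ab_smult)
  moreover have "\<omega> (ps @ (0 \<odot>\<^bsub>ab\<^esub> proj z) # qs) = 0 * \<omega> (ps @ proj z # qs)"
    using z by (intro alt_forms_smult [OF \<omega>] ab.smult_closed proj_mem) auto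
  ultimately show ?thesis
    by simp
qed

lemma pullback_horizontal:
  assumes \<omega>: "\<omega> \<in> alt_forms ab k"
  shows "pullback g proj \<omega> \<in> horizontal_forms n k"
proof -
  have "pullback g proj \<omega> \<in> alt_forms g k"
  proof (rule heis.alt_formsI)
    fix xs assume "length xs \<noteq> k \<or> \<not> set xs \<subseteq> carrier g"
    then show "pullback g proj \<omega> xs = 0"
      using alt_forms_support [OF \<omega>, of "map proj xs"] by (auto simp: pullback_def)
  next
    fix ps qs x y assume xy: "x \<in> carrier g" "y \<in> carrier g"
    then show "pullback g proj \<omega> (ps @ (x \<oplus>\<^bsub>g\<^esub> y) # qs)
        = pullback g proj \<omega> (ps @ x # qs) + pullback g proj \<omega> (ps @ y # qs)"
      using ab.alt_forms_additive [OF \<omega> proj_mem proj_mem, OF xy] by (auto simp: pullback_def ab_add)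
  next
    fix ps qs a x assume x: "x \<in> carrier g"
    then show "pullback g proj \<omega> (ps @ (a \<odot>\<^bsub>g\<^esub> x) # qs) = a * pullback g proj \<omega> (ps @ x # qs)"
      using alt_forms_smult [OF \<omega> proj_mem ab.smult_closed, OF x proj_mem [OF x]]
      by (auto simp: pullback_def ab_smult)
  next
    show "pullback g proj \<omega> (ps @ x # x # qs) = 0" for ps qs x
      using alt_forms_repeat [OF \<omega>, of _ _ "[]"] by (simp add: pullback_def)
  qed
  moreover have "contract z (pullback g proj \<omega>) = (\<lambda>xs. 0)"
    using ab_form_z [OF \<omega>, of "[]"] by (auto simp: contract_def pullback_def)
  ultimately show ?thesis
    by (simp add: horizontal_forms_def)
qed

text \<open>Two lifts of an element of the abelianization differ by a multiple of \<open>z\<close>, which a horizontal form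
  does not see.\<close>

lemma horizontal_proj_cong:
  assumes "\<omega> \<in> horizontal_forms n k" "set xs \<subseteq> carrier g" "set ys \<subseteq> carrier g" "map proj xs = map proj ys"
  shows "\<omega> xs = \<omega> ys"
  using assms
proof (induction xs arbitrary: ys \<omega> k)
  case (Cons x xs)
  then obtain y ys' where ys: "ys = y # ys'" "proj x = proj y" "map proj xs = map proj ys'"
    by auto
  then have y: "y \<in> carrier g" and x: "x \<in> carrier g"
    using Cons.prems by auto
  obtain c where c: "x = c \<cdot>\<^sub>v z + y"
    using proj_eq_iff [OF x y] ys by auto
  note \<omega> = horizontal_formsD [OF Cons.prems(1)]
  have "contract x \<omega> xs = contract x \<omega> ys'"
    by (rule Cons.IH [OF horizontal_contract_closed [OF Cons.prems(1)]]) (use Cons.prems ys in auto)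
  moreover have "contract x \<omega> = (\<lambda>xs. contract (c \<cdot>\<^sub>v z) \<omega> xs + contract y \<omega> xs)"
    using heis.contract_add [OF \<omega>(1), of "c \<cdot>\<^sub>v z" y] y z c by simp
  moreover have "contract (c \<cdot>\<^sub>v z) \<omega> = (\<lambda>xs. 0)"
    using heis.contract_smult [OF \<omega>(1), of z c] z \<omega>(2) by simp
  ultimately show ?case
    by (simp add: ys contract_def fun_eq_iff)
qed simp

text \<open>Any choice of representatives will do, by the preceding lemma.\<close>

definition descend :: "(real vec list \<Rightarrow> real) \<Rightarrow> real vec set list \<Rightarrow> real" where
  "descend \<omega> Cs = (if set Cs \<subseteq> carrier ab then \<omega> (map (\<lambda>C. SOME x. x \<in> carrier g \<and> proj x = C) Cs) else 0)"

lemma descend_proj: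
  assumes \<omega>: "\<omega> \<in> horizontal_forms n k" and xs: "set xs \<subseteq> carrier g"
  shows "descend \<omega> (map proj xs) = \<omega> xs"
proof -
  let ?rep = "\<lambda>C. SOME x. x \<in> carrier g \<and> proj x = C"
  have rep: "?rep (proj x) \<in> carrier g \<and> proj (?rep (proj x)) = proj x" if "x \<in> carrier g" for x
    by (rule someI [of "\<lambda>y. y \<in> carrier g \<and> proj y = proj x" x]) (use that in blast)
  have "\<omega> (map ?rep (map proj xs)) = \<omega> xs"
    by (rule horizontal_proj_cong [OF \<omega>]) (use xs rep in \<open>auto simp del: heisenberg_simps\<close>)
  moreover have "set (map proj xs) \<subseteq> carrier ab"
    using xs proj_mem by auto
  ultimately show ?thesis
    by (simp add: descend_def)
qed

lemma proj_lift: "set Cs \<subseteq> carrier ab \<Longrightarrow> \<exists>xs. set xs \<subseteq> carrier g \<and> Cs = map proj xs"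
proof (induction Cs)
  case (Cons C Cs)
  then obtain xs where xs: "set xs \<subseteq> carrier g" "Cs = map proj xs"
    by auto
  moreover obtain x where "x \<in> carrier g" "C = proj x"
    using Cons.prems by (auto simp: ab_carrier)
  ultimately show ?case
    by (intro exI [of _ "x # xs"]) simp
qed simp

lemma descend_alt:
  assumes \<omega>: "\<omega> \<in> horizontal_forms n k"
  shows "descend \<omega> \<in> alt_forms ab k"
proof -
  note alt = horizontal_formsD(1) [OF \<omega>]
  have out: "descend \<omega> Cs = 0" if "\<not> set Cs \<subseteq> carrier ab" for Cs
    using that by (simp add: descend_def)
  show ?thesis
  proof (rule ab.alt_formsI)
    fix Cs assume "length Cs \<noteq> k \<or> \<not> set Cs \<subseteq> carrier ab"
    then show "descend \<omega> Cs = 0"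
      using alt_forms_support [OF alt] by (auto simp: descend_def)
  next
    fix ps qs C D assume CD: "C \<in> carrier ab" "D \<in> carrier ab"
    show "descend \<omega> (ps @ (C \<oplus>\<^bsub>ab\<^esub> D) # qs) = descend \<omega> (ps @ C # qs) + descend \<omega> (ps @ D # qs)"
    proof (cases "set ps \<subseteq> carrier ab \<and> set qs \<subseteq> carrier ab")
      case True
      then obtain us vs where us: "set us \<subseteq> carrier g" "ps = map proj us"
        and vs: "set vs \<subseteq> carrier g" "qs = map proj vs"
        using proj_lift by metis
      obtain x y where x: "x \<in> carrier g" "C = proj x" and y: "y \<in> carrier g" "D = proj y"
        using CD by (auto simp: ab_carrier)
      show ?thesis
        using descend_proj [OF \<omega>, of "us @ (x + y) # vs"] descend_proj [OF \<omega>, of "us @ x # vs"]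
          descend_proj [OF \<omega>, of "us @ y # vs"] heis.alt_forms_additive [OF alt x(1) y(1), of us vs] us vs x y
        by (simp add: ab_add)
    next
      case False
      then show ?thesis
        by (simp add: out)
    qed
  next
    fix ps qs a C assume C: "C \<in> carrier ab"
    show "descend \<omega> (ps @ (a \<odot>\<^bsub>ab\<^esub> C) # qs) = a * descend \<omega> (ps @ C # qs)"
    proof (cases "set ps \<subseteq> carrier ab \<and> set qs \<subseteq> carrier ab")
      case True
      then obtain us vs where us: "set us \<subseteq> carrier g" "ps = map proj us"
        and vs: "set vs \<subseteq> carrier g" "qs = map proj vs"
        using proj_lift by metis
      obtain x where x: "x \<in> carrier g" "C = proj x"
        using C by (auto simp: ab_carrier)
      show ?thesis
        using descend_proj [OF \<omega>, of "us @ (a \<cdot>\<^sub>v x) # vs"] descend_proj [OF \<omega>, of "us @ x # vs"]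
          alt_forms_smult [OF alt x(1) heis.smult_closed [OF x(1)], of us a vs] us vs x
        by (simp add: ab_smult)
    next
      case False
      then show ?thesis
        by (simp add: out)
    qed
  next
    fix ps qs C
    show "descend \<omega> (ps @ C # C # qs) = 0"
      using alt_forms_repeat [OF alt, of _ _ "[]"] by (simp add: descend_def)
  qed
qed

lemma pullback_image: "pullback g proj ` alt_forms ab k = horizontal_forms n k"
proof (intro equalityI subsetI)
  fix \<omega> assume "\<omega> \<in> pullback g proj ` alt_forms ab k"
  then show "\<omega> \<in> horizontal_forms n k"
    using pullback_horizontal by auto
next
  fix \<omega> assume \<omega>: "\<omega> \<in> horizontal_forms n k"
  have "pullback g proj (descend \<omega>) xs = \<omega> xs" for xs
    using descend_proj [OF \<omega>] alt_forms_support [OF horizontal_formsD(1) [OF \<omega>]]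
    by (simp add: pullback_def del: heisenberg_simps)
  then have "\<omega> = pullback g proj (descend \<omega>)"
    by (simp add: fun_eq_iff)
  then show "\<omega> \<in> pullback g proj ` alt_forms ab k"
    using descend_alt [OF \<omega>] by (rule image_eqI)
qed

lemma ab_dual_basis:
  "dual_basis_space ab (\<lambda>i. proj (unit_vec (2 * n + 1) i)) (\<lambda>i. descend (heis_coord n i)) (2 * n)"
proof
  fix i assume "i < 2 * n"
  then show "descend (heis_coord n i) \<in> alt_forms ab 1"
    by (intro descend_alt coord_horizontal)
next
  fix \<psi> C assume \<psi>: "\<psi> \<in> alt_forms ab 1" and C: "C \<in> carrier ab"
  obtain x where x: "x \<in> carrier g" "C = proj x"
    using C by (auto simp: ab_carrier)
  let ?\<rho> = "pullback g proj \<psi>" and ?e = "unit_vec (2 * n + 1) :: nat \<Rightarrow> real vec"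
  have at: "?\<rho> [y] = \<psi> [proj y]" if "y \<in> carrier g" for y
    using that by (simp add: pullback_def)
  have "\<psi> [C] = (\<Sum>i<2 * n + 1. heis_coord n i [x] * ?\<rho> [?e i])"
    using heis_one_form_expand [OF horizontal_formsD(1) [OF pullback_horizontal [OF \<psi>]] x(1)] at [OF x(1)] x(2)
    by simp
  also have "\<dots> = (\<Sum>i<2 * n. heis_coord n i [x] * ?\<rho> [?e i])"
    using ab_form_z [OF \<psi>, of "[]" "[]"] at [of "?e (2 * n)"] by (simp add: heis_z_def)
  also have "\<dots> = (\<Sum>i<2 * n. descend (heis_coord n i) [C] * \<psi> [proj (?e i)])"
    using descend_proj [OF coord_horizontal, of _ "[x]"] x at by (intro sum.cong refl) simp
  finally show "\<psi> [C] = (\<Sum>i<2 * n. descend (heis_coord n i) [C] * \<psi> [proj (?e i)])" .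
qed (simp add: proj_mem)

text \<open>All brackets of the abelianization vanish, so the zero map has the defining properties of the
  differential.\<close>

lemma ab_CE_differential: "CE_differential ab = restrict (\<lambda>\<omega> xs. 0) (\<Union>k. alt_forms ab k)" (is "_ = ?D")
proof (rule CE_differential_eqI [OF ab_dual_basis])
  have D: "?D \<omega> = (\<lambda>xs. 0)" if "\<omega> \<in> alt_forms ab k" for \<omega> k
    by (rule restrict_apply') (use that in blast)
  show "is_CE_differential ab ?D"
    unfolding is_CE_differential_def
  proof (intro conjI allI ballI)
    show "linear_map class_ring (cochains ab k) (cochains ab (Suc k)) ?D" for k
    proof (rule linear_map_cochainsI)
      fix \<alpha> assume \<alpha>: "\<alpha> \<in> alt_forms ab k"
      show "?D \<alpha> \<in> alt_forms ab (Suc k)"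
        unfolding D [OF \<alpha>] by simp
      show "?D (\<lambda>xs. c * \<alpha> xs) = (\<lambda>xs. c * ?D \<alpha> xs)" for c
        unfolding D [OF \<alpha>] D [OF alt_forms_scale_closed [OF \<alpha>]] by simp
      fix \<beta> assume \<beta>: "\<beta> \<in> alt_forms ab k"
      show "?D (\<lambda>xs. \<alpha> xs + \<beta> xs) = (\<lambda>xs. ?D \<alpha> xs + ?D \<beta> xs)"
        unfolding D [OF \<alpha>] D [OF \<beta>] D [OF alt_forms_sum_closed [OF \<alpha> \<beta>]] by simp
    qed
  next
    fix k l \<alpha> \<beta> assume \<alpha>: "\<alpha> \<in> alt_forms ab k" and \<beta>: "\<beta> \<in> alt_forms ab l"
    show "?D (wedge \<alpha> \<beta>) = (\<lambda>xs. wedge (?D \<alpha>) \<beta> xs + (-1) ^ k * wedge \<alpha> (?D \<beta>) xs)"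
      unfolding D [OF \<alpha>] D [OF \<beta>] D [OF ab.wedge_alt [OF \<alpha> \<beta>]] by simp
  next
    fix \<phi> C D' assume \<phi>: "\<phi> \<in> alt_forms ab 1" and CD: "C \<in> carrier ab" "D' \<in> carrier ab"
    show "?D \<phi> [C, D'] = \<phi> [bracket ab C D']"
      unfolding D [OF \<phi>] ab_bracket [OF CD] using ab_form_z [OF \<phi>, of "[]" "[]"] by simp
  next
    show "?D \<in> extensional (\<Union>k. alt_forms ab k)"
      by (rule restrict_extensional)
  qed
qed

lemma ab_CE_differential_apply:
  assumes "\<omega> \<in> alt_forms ab k"
  shows "CE_differential ab \<omega> = (\<lambda>xs. 0)"
  unfolding ab_CE_differential by (rule restrict_apply') (use assms in blast)

lemma ab_cocycles: "cocycles ab k = alt_forms ab k"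
  unfolding cocycles_def using ab_CE_differential_apply by blast

lemma ab_coboundaries: "coboundaries ab k = {\<lambda>xs. 0}"
proof (cases k)
  case (Suc l)
  have "coboundaries ab k = (\<lambda>\<omega> xs. 0) ` alt_forms ab l"
    unfolding Suc coboundaries.simps by (intro image_cong refl ab_CE_differential_apply)
  moreover have "alt_forms ab l \<noteq> {}"
    using alt_forms_zero_form by blast
  ultimately show ?thesis
    by (simp add: image_constant_conv)
qed simp

lemma ab_cohomology_carrier: "carrier (cohomology ab k) = (\<lambda>\<omega>. {\<omega>}) ` alt_forms ab k"
  by (auto simp: cohomology_def quotient_space_def A_RCOSETS_def' a_r_coset_def r_coset_def
      ab_cocycles ab_coboundaries)

text \<open>As the abelianization has zero differential, its cohomology classes are single forms, and these are
  the horizontal forms.\<close>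

lemma heis_basic_cohomology:
  "basic_cohomology g k
    = (\<lambda>\<omega>. coboundaries g k +>\<^bsub>cochains g k\<^esub> \<omega>) ` horizontal_forms n k"
  unfolding basic_cohomology_def ab_cohomology_carrier pullback_image [symmetric] image_image
  by (simp add: cohomology_map_def del: coboundaries.simps)

end

section \<open>Basic cohomology and the independence polynomial\<close>

declare coboundaries.simps [simp del]

text \<open>The vector space axioms pass to surjective images. This is applied to the classes of horizontal
  forms: the space of basic classes becomes a vector space without a construction of the whole
  cohomology space.\<close>

lemma vectorspace_surjective_image:
  fixes V :: "(real, 'v, 'm) module_scheme" and Q :: "(real, 'w, 'k) module_scheme"
  assumes V: "vectorspace class_ring V" and surj: "T ` carrier V = carrier Q"
    and add: "\<And>v w. v \<in> carrier V \<Longrightarrow> w \<in> carrier V \<Longrightarrow> T (v \<oplus>\<^bsub>V\<^esub> w) = T v \<oplus>\<^bsub>Q\<^esub> T w"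
    and smult: "\<And>a v. v \<in> carrier V \<Longrightarrow> T (a \<odot>\<^bsub>V\<^esub> v) = a \<odot>\<^bsub>Q\<^esub> T v"
    and zero: "T \<zero>\<^bsub>V\<^esub> = \<zero>\<^bsub>Q\<^esub>"
  shows "linear_map class_ring V Q T"
proof -
  interpret V: vectorspace class_ring V by (rule V)
  have module_laws: "(a * b) \<odot>\<^bsub>V\<^esub> v = a \<odot>\<^bsub>V\<^esub> (b \<odot>\<^bsub>V\<^esub> v)" "1 \<odot>\<^bsub>V\<^esub> v = v"
    "(a + b) \<odot>\<^bsub>V\<^esub> v = a \<odot>\<^bsub>V\<^esub> v \<oplus>\<^bsub>V\<^esub> b \<odot>\<^bsub>V\<^esub> v" if "v \<in> carrier V" for a b v
    using V.smult_assoc1 [of a b v] V.smult_one [of v] V.smult_l_distr [of a b v] that by simp_all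
  have Q: "vectorspace class_ring Q"
  proof (rule vs_criteria)
    show "\<forall>v\<in>carrier Q. \<exists>w\<in>carrier Q. v \<oplus>\<^bsub>Q\<^esub> w = \<zero>\<^bsub>Q\<^esub>"
    proof
      fix v assume "v \<in> carrier Q"
      then obtain u where u: "u \<in> carrier V" "v = T u"
        using surj by blast
      then have "v \<oplus>\<^bsub>Q\<^esub> T (\<ominus>\<^bsub>V\<^esub> u) = \<zero>\<^bsub>Q\<^esub>"
        by (simp add: V.M.r_neg zero flip: add)
      then show "\<exists>w\<in>carrier Q. v \<oplus>\<^bsub>Q\<^esub> w = \<zero>\<^bsub>Q\<^esub>"
        using u surj by (intro bexI [of _ "T (\<ominus>\<^bsub>V\<^esub> u)"]) auto
    qed
    show "\<zero>\<^bsub>Q\<^esub> \<in> carrier Q"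
      using zero surj by (metis V.M.zero_closed imageI)
  qed (auto simp: class_field V.M.a_ac module_laws V.smult_r_distr
      simp flip: surj add smult zero)
  interpret Q: vectorspace class_ring Q by (rule Q)
  show ?thesis
    by unfold_locales (use surj in \<open>auto simp: LinearCombinations.module_hom_def add smult\<close>)
qed

lemma (in vectorspace) dim_zero_carrier:
  assumes "fin_dim" "dim = 0"
  shows "carrier V = {\<zero>\<^bsub>V\<^esub>}"
proof -
  obtain A where A: "finite A" "basis A"
    using finite_basis_exists [OF assms(1)] by blast
  then have "A = {}"
    using dim_basis assms(2) by simp
  then have "carrier V = span {}"
    using A(2) by (simp add: basis_def)
  then show ?thesis
    by (auto simp: span_def lincomb_def)
qed

lemma dim_zero_space:
  assumes "vectorspace class_ring (V :: (real, 'v, 'm) module_scheme)" "carrier V = {\<zero>\<^bsub>V\<^esub>}"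
  shows "vectorspace.dim class_ring V = 0"
  using dim_by_coordinates(2) [OF assms(1), of "{}" "\<lambda>v i. 0" "\<lambda>i. \<zero>\<^bsub>V\<^esub>"] assms(2) by simp

text \<open>Cohomology classes are sets of forms, so addition and multiples of classes have to be computed
  as operations on cosets.\<close>

context
  fixes B :: "('b list \<Rightarrow> real) set"
  assumes B_zero: "(\<lambda>xs. 0) \<in> B"
    and B_add: "\<And>\<alpha> \<beta>. \<alpha> \<in> B \<Longrightarrow> \<beta> \<in> B \<Longrightarrow> (\<lambda>xs. \<alpha> xs + \<beta> xs) \<in> B"
    and B_scale: "\<And>c \<alpha>. \<alpha> \<in> B \<Longrightarrow> (\<lambda>xs. c * \<alpha> xs) \<in> B"
begin

lemma mem_coset: "\<omega> \<in> B +>\<^bsub>cochains V k\<^esub> \<alpha> \<longleftrightarrow> (\<lambda>xs. \<omega> xs - \<alpha> xs) \<in> B"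
proof
  assume "(\<lambda>xs. \<omega> xs - \<alpha> xs) \<in> B"
  then show "\<omega> \<in> B +>\<^bsub>cochains V k\<^esub> \<alpha>"
    by (force simp: a_r_coset_def r_coset_def)
qed (auto simp: a_r_coset_def r_coset_def)

lemma coset_shift:
  assumes "\<beta> \<in> B"
  shows "B +>\<^bsub>cochains V k\<^esub> (\<lambda>xs. \<beta> xs + \<alpha> xs) = B +>\<^bsub>cochains V k\<^esub> \<alpha>"
proof -
  have "(\<lambda>xs. \<omega> xs - (\<beta> xs + \<alpha> xs)) \<in> B \<longleftrightarrow> (\<lambda>xs. \<omega> xs - \<alpha> xs) \<in> B" for \<omega>
    using B_add [OF _ assms, of "\<lambda>xs. \<omega> xs - (\<beta> xs + \<alpha> xs)"]
      B_add [OF _ B_scale [OF assms, of "- 1"], of "\<lambda>xs. \<omega> xs - \<alpha> xs"]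
    by (auto simp: algebra_simps)
  then show ?thesis
    by (auto simp: mem_coset)
qed

lemma coset_zero: "B +>\<^bsub>cochains V k\<^esub> (\<lambda>xs. 0) = B"
  by (auto simp: mem_coset)

lemma coset_eq_iff: "B +>\<^bsub>cochains V k\<^esub> \<alpha> = B \<longleftrightarrow> \<alpha> \<in> B"
  using coset_shift [of \<alpha> V k "\<lambda>xs. 0"] mem_coset [of \<alpha> V k \<alpha>] B_zero by (auto simp: coset_zero)

lemma coset_sum:
  "(B +>\<^bsub>cochains V k\<^esub> \<alpha>) <+>\<^bsub>cochains V k\<lparr>carrier := Z\<rparr>\<^esub> (B +>\<^bsub>cochains V k\<^esub> \<beta>)
    = B +>\<^bsub>cochains V k\<^esub> (\<lambda>xs. \<alpha> xs + \<beta> xs)" (is "?l = ?r")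
proof (intro equalityI subsetI)
  fix \<omega> assume "\<omega> \<in> ?l"
  then obtain \<mu> \<nu> where "\<omega> = (\<lambda>xs. \<mu> xs + \<nu> xs)" "(\<lambda>xs. \<mu> xs - \<alpha> xs) \<in> B" "(\<lambda>xs. \<nu> xs - \<beta> xs) \<in> B"
    by (auto simp: set_add_def' mem_coset)
  then show "\<omega> \<in> ?r"
    using B_add [of "\<lambda>xs. \<mu> xs - \<alpha> xs" "\<lambda>xs. \<nu> xs - \<beta> xs"] by (simp add: mem_coset algebra_simps)
next
  fix \<omega> assume "\<omega> \<in> ?r"
  then have "(\<lambda>xs. \<omega> xs - \<beta> xs) \<in> B +>\<^bsub>cochains V k\<^esub> \<alpha>"
    by (simp add: mem_coset algebra_simps)
  moreover have "\<beta> \<in> B +>\<^bsub>cochains V k\<^esub> \<beta>"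
    using B_zero by (simp add: mem_coset)
  moreover have "\<omega> = (\<lambda>xs. (\<omega> xs - \<beta> xs) + \<beta> xs)"
    by simp
  ultimately show "\<omega> \<in> ?l"
    unfolding set_add_def' cochains_simps by (auto intro!: bexI)
qed

lemma coset_scale:
  "(\<Union>\<omega>\<in>B +>\<^bsub>cochains V k\<^esub> \<alpha>. B +>\<^bsub>cochains V k\<^esub> (\<lambda>xs. c * \<omega> xs)) = B +>\<^bsub>cochains V k\<^esub> (\<lambda>xs. c * \<alpha> xs)"
proof -
  have "B +>\<^bsub>cochains V k\<^esub> (\<lambda>xs. c * \<omega> xs) = B +>\<^bsub>cochains V k\<^esub> (\<lambda>xs. c * \<alpha> xs)"
    if "\<omega> \<in> B +>\<^bsub>cochains V k\<^esub> \<alpha>" for \<omega>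
    using coset_shift [OF B_scale [of "\<lambda>xs. \<omega> xs - \<alpha> xs" c], of V k "\<lambda>xs. c * \<alpha> xs"] that
    by (simp add: mem_coset algebra_simps)
  moreover have "\<alpha> \<in> B +>\<^bsub>cochains V k\<^esub> \<alpha>"
    using B_zero by (simp add: mem_coset)
  ultimately show ?thesis
    by blast
qed

end

lemma heis_coboundaries_subspace:
  shows "(\<lambda>xs. 0) \<in> coboundaries (heisenberg n) k"
    and "\<alpha> \<in> coboundaries (heisenberg n) k \<Longrightarrow> \<beta> \<in> coboundaries (heisenberg n) k
      \<Longrightarrow> (\<lambda>xs. \<alpha> xs + \<beta> xs) \<in> coboundaries (heisenberg n) k"
    and "\<alpha> \<in> coboundaries (heisenberg n) k \<Longrightarrow> (\<lambda>xs. c * \<alpha> xs) \<in> coboundaries (heisenberg n) k"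
proof -
  let ?\<Omega> = "heis_symplectic n"
  show "(\<lambda>xs. 0) \<in> coboundaries (heisenberg n) k"
    by (auto simp: heis_coboundaries intro!: image_eqI [where x = "\<lambda>xs. 0"])
  show "(\<lambda>xs. \<alpha> xs + \<beta> xs) \<in> coboundaries (heisenberg n) k"
    if "\<alpha> \<in> coboundaries (heisenberg n) k" "\<beta> \<in> coboundaries (heisenberg n) k"
    using that by (auto simp: heis_coboundaries split: if_splits simp flip: wedge_add_right
        intro!: imageI horizontal_add_closed)
  show "(\<lambda>xs. c * \<alpha> xs) \<in> coboundaries (heisenberg n) k" if "\<alpha> \<in> coboundaries (heisenberg n) k"
    using that by (auto simp: heis_coboundaries split: if_splits simp flip: wedge_scale_right
        intro!: imageI horizontal_scale_closed)
qed

lemma heis_coboundaries_horizontal: "coboundaries (heisenberg n) k \<subseteq> horizontal_forms n k"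
proof (cases "k < 2")
  case False
  then have "2 + (k - 2) = k"
    by simp
  then show ?thesis
    using horizontal_wedge_closed [OF symplectic_horizontal, of _ n "k - 2"] False
    by (auto simp: heis_coboundaries simp del: add_2_eq_Suc)
qed (simp add: heis_coboundaries)

abbreviation basic_space :: "nat \<Rightarrow> nat \<Rightarrow> (real, (real vec list \<Rightarrow> real) set) module" where
  "basic_space n k \<equiv> cohomology (heisenberg n) k\<lparr>carrier := basic_cohomology (heisenberg n) k\<rparr>"

lemma basic_class_map:
  assumes "n \<ge> 1"
  shows "linear_map class_ring (horizontal_space n k) (basic_space n k)
    (\<lambda>\<omega>. coboundaries (heisenberg n) k +>\<^bsub>cochains (heisenberg n) k\<^esub> \<omega>)" (is "linear_map _ _ _ ?T")
proof (rule vectorspace_surjective_image [OF horizontal_vectorspace])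
  note B = heis_coboundaries_subspace [where n = n and k = k]
  show "?T ` carrier (horizontal_space n k) = carrier (basic_space n k)"
    using heis_basic_cohomology [OF assms] by simp
  have add: "C \<oplus>\<^bsub>basic_space n k\<^esub> D
      = C <+>\<^bsub>cochains (heisenberg n) k\<lparr>carrier := cocycles (heisenberg n) k\<rparr>\<^esub> D" for C D
    by (simp add: cohomology_def quotient_space_def)
  have smult: "a \<odot>\<^bsub>basic_space n k\<^esub> C = (\<Union>\<omega>\<in>C. ?T (\<lambda>xs. a * \<omega> xs))" for a C
    by (simp add: cohomology_def quotient_space_def a_r_coset_def r_coset_def)
  have zero: "\<zero>\<^bsub>basic_space n k\<^esub> = coboundaries (heisenberg n) k"
    by (simp add: cohomology_def quotient_space_def)
  have forms: "v \<oplus>\<^bsub>horizontal_space n k\<^esub> w = (\<lambda>xs. v xs + w xs)"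
    "a \<odot>\<^bsub>horizontal_space n k\<^esub> v = (\<lambda>xs. a * v xs)" "\<zero>\<^bsub>horizontal_space n k\<^esub> = (\<lambda>xs. 0)" for a v w
    by simp_all
  show "?T (v \<oplus>\<^bsub>horizontal_space n k\<^esub> w) = ?T v \<oplus>\<^bsub>basic_space n k\<^esub> ?T w" for v w
    unfolding add forms
    by (rule coset_sum [OF B, where V = "heisenberg n" and k = k and \<alpha> = v and \<beta> = w, symmetric])
  show "?T (a \<odot>\<^bsub>horizontal_space n k\<^esub> v) = a \<odot>\<^bsub>basic_space n k\<^esub> ?T v" for a v
    unfolding smult forms
    by (rule coset_scale [OF B, where V = "heisenberg n" and k = k and \<alpha> = v and c = a, symmetric])
  show "?T \<zero>\<^bsub>horizontal_space n k\<^esub> = \<zero>\<^bsub>basic_space n k\<^esub>"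
    unfolding zero forms by (rule coset_zero [OF B])
qed

text \<open>Rank-nullity for the map taking a horizontal form to its class, whose kernel consists of the
  coboundaries.\<close>

lemma basic_betti_plus_exact:
  assumes "n \<ge> 1"
  shows "basic_betti (heisenberg n) k
      + vectorspace.dim class_ring (cochains (heisenberg n) k\<lparr>carrier := coboundaries (heisenberg n) k\<rparr>)
    = (2 * n) choose k"
    and "basic_betti (heisenberg n) k = 0 \<longleftrightarrow> horizontal_forms n k \<subseteq> coboundaries (heisenberg n) k"
proof -
  let ?B = "coboundaries (heisenberg n) k"
  let ?T = "\<lambda>\<omega>. ?B +>\<^bsub>cochains (heisenberg n) k\<^esub> \<omega>"
  interpret T: linear_map class_ring "horizontal_space n k" "basic_space n k" ?T
    by (rule basic_class_map [OF assms])
  have surj: "?T ` carrier (horizontal_space n k) = carrier (basic_space n k)"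
    using heis_basic_cohomology [OF assms] by simp
  have zero: "\<zero>\<^bsub>basic_space n k\<^esub> = ?B"
    by (simp add: cohomology_def quotient_space_def)
  have T_zero: "?T \<omega> = \<zero>\<^bsub>basic_space n k\<^esub> \<longleftrightarrow> \<omega> \<in> ?B" for \<omega>
    unfolding zero by (rule coset_eq_iff [OF heis_coboundaries_subspace])
  have "T.ker = ?B"
    unfolding T.ker_def T_zero using heis_coboundaries_horizontal by auto
  moreover have "T.im = basic_cohomology (heisenberg n) k"
    unfolding T.im_def surj by simp
  ultimately show "basic_betti (heisenberg n) k
      + vectorspace.dim class_ring (cochains (heisenberg n) k\<lparr>carrier := ?B\<rparr>) = (2 * n) choose k"
    using T.rank_nullity [OF horizontal_dim(1)] by (simp add: basic_betti_def horizontal_dim(2))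
  show "basic_betti (heisenberg n) k = 0 \<longleftrightarrow> horizontal_forms n k \<subseteq> ?B"
  proof
    assume "basic_betti (heisenberg n) k = 0"
    then have "carrier (basic_space n k) = {\<zero>\<^bsub>basic_space n k\<^esub>}"
      using T.rank_nullity_main(2) [OF horizontal_dim(1) surj]
      by (intro T.W.dim_zero_carrier) (simp_all add: basic_betti_def)
    moreover have "?T \<omega> \<in> carrier (basic_space n k)" if "\<omega> \<in> horizontal_forms n k" for \<omega>
      by (rule T.f_im) (simp add: that)
    ultimately have "?T \<omega> = \<zero>\<^bsub>basic_space n k\<^esub>" if "\<omega> \<in> horizontal_forms n k" for \<omega>
      using that by blast
    then show "horizontal_forms n k \<subseteq> ?B"
      by (intro subsetI T_zero [THEN iffD1])
  next
    assume exact: "horizontal_forms n k \<subseteq> ?B"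
    have trivial: "?T \<omega> = \<zero>\<^bsub>basic_space n k\<^esub>" if "\<omega> \<in> horizontal_forms n k" for \<omega>
      by (rule T_zero [THEN iffD2]) (use exact that in blast)
    have "?T (\<lambda>xs. 0) \<in> carrier (basic_space n k)"
      by (rule T.f_im) simp
    then have "\<zero>\<^bsub>basic_space n k\<^esub> \<in> carrier (basic_space n k)"
      unfolding trivial [OF horizontal_zero_form] .
    moreover have "C = \<zero>\<^bsub>basic_space n k\<^esub>" if "C \<in> carrier (basic_space n k)" for C
    proof -
      from that obtain \<omega> where "\<omega> \<in> carrier (horizontal_space n k)" "C = ?T \<omega>"
        unfolding surj [symmetric] ..
      then show ?thesis
        using trivial [of \<omega>] by simp
    qed
    ultimately have "carrier (basic_space n k) = {\<zero>\<^bsub>basic_space n k\<^esub>}"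
      by blast
    then show "basic_betti (heisenberg n) k = 0"
      unfolding basic_betti_def by (intro dim_zero_space T.W.vectorspace_axioms)
  qed
qed

text \<open>Rank-nullity for the Lefschetz operator, which is injective in this range.\<close>

lemma heis_coboundaries_dim:
  assumes "k \<le> n + 1"
  shows "vectorspace.dim class_ring (cochains (heisenberg n) k\<lparr>carrier := coboundaries (heisenberg n) k\<rparr>)
    = (if k < 2 then 0 else (2 * n) choose (k - 2))"
proof (cases "k < 2")
  case True
  interpret vectorspace class_ring "cochains (heisenberg n) k" by (rule cochains_vectorspace)
  have "vectorspace class_ring (cochains (heisenberg n) k\<lparr>carrier := {\<lambda>xs. 0}\<rparr>)"
    by (rule subspace_is_vs, rule subspace.intro, rule cochains_vectorspace, unfold_locales) auto
  then have "vectorspace.dim class_ring (cochains (heisenberg n) k\<lparr>carrier := {\<lambda>xs. 0}\<rparr>) = 0"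
    by (rule dim_zero_space) simp
  then show ?thesis
    using True by (simp add: heis_coboundaries)
next
  case False
  then obtain l where k: "k = l + 2"
    by (metis add.commute le_Suc_ex not_less)
  let ?L = "wedge (heis_symplectic n)"
  interpret A: vectorspace class_ring "horizontal_space n l" by (rule horizontal_vectorspace)
  interpret C: vectorspace class_ring "horizontal_space n k" by (rule horizontal_vectorspace)
  interpret L: linear_map class_ring "horizontal_space n l" "horizontal_space n k" ?L
    by unfold_locales
       (use horizontal_wedge_closed [OF symplectic_horizontal, of _ n l] k in
         \<open>auto simp: LinearCombinations.module_hom_def wedge_add_right wedge_scale_right add.commute\<close>)
  have im: "L.im = coboundaries (heisenberg n) k"
    unfolding L.im_def using k by (simp add: heis_coboundaries)
  have ker: "L.ker = {\<lambda>xs. 0}"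
    unfolding L.ker_def using lefschetz_injective [of _ n l] assms k by auto
  have update: "horizontal_space n i\<lparr>carrier := W\<rparr> = cochains (heisenberg n) i\<lparr>carrier := W\<rparr>" for i W
    by simp
  have "vectorspace.dim class_ring (cochains (heisenberg n) l\<lparr>carrier := {\<lambda>xs. 0}\<rparr>) = 0"
    using A.subspace_is_vs [OF L.kerT_is_subspace] unfolding ker update by (rule dim_zero_space) simp
  then have "vectorspace.dim class_ring (cochains (heisenberg n) k\<lparr>carrier := coboundaries (heisenberg n) k\<rparr>)
      = (2 * n) choose l"
    using L.rank_nullity [OF horizontal_dim(1)] unfolding im ker update horizontal_dim(2) by linarith
  moreover have "k - 2 = l"
    using k by simp
  ultimately show ?thesis
    by (simp only: if_not_P [OF False])
qed

lemma heis_basic_betti_low: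
  assumes "n \<ge> 1" "k \<le> n + 1"
  shows "basic_betti (heisenberg n) k + (if k < 2 then 0 else (2 * n) choose (k - 2)) = (2 * n) choose k"
  using basic_betti_plus_exact(1) [OF assms(1), of k] heis_coboundaries_dim [OF assms(2)] by simp

text \<open>In degree \<open>n + 1\<close> the two binomial coefficients agree by symmetry, so every horizontal form of that
  degree is exact; the higher degrees follow from this one.\<close>

lemma heis_basic_betti_high:
  assumes n: "n \<ge> 1" and k: "k > n"
  shows "basic_betti (heisenberg n) k = 0"
proof -
  have "(2 * n) choose (n + 1) = (2 * n) choose (n - 1)"
    using n binomial_symmetric [of "n + 1" "2 * n"] by (simp add: numeral_2_eq_2)
  then have "basic_betti (heisenberg n) (n + 1) = 0"
    using heis_basic_betti_low [OF n, of "n + 1"] n by (simp split: if_splits)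
  then have "horizontal_forms n (n - 1 + 2) \<subseteq> wedge (heis_symplectic n) ` horizontal_forms n (n - 1)"
    using basic_betti_plus_exact(2) [OF n, of "n + 1"] n unfolding heis_coboundaries by simp
  moreover have degree: "n - 1 + (k - n - 1) = k - 2" "k - 2 + 2 = k"
    using n k by auto
  ultimately have "horizontal_forms n k \<subseteq> wedge (heis_symplectic n) ` horizontal_forms n (k - 2)"
    using horizontal_above_middle_exact [of n "n - 1" "k - n - 1"] unfolding degree by blast
  then have "horizontal_forms n k \<subseteq> coboundaries (heisenberg n) k"
    using n k unfolding heis_coboundaries by simp
  then show ?thesis
    using basic_betti_plus_exact(2) [OF n] by simp
qed

lemma heis_independence_number:
  assumes n: "n \<ge> 1"
  shows "independence_number (heisenberg n) = n"
  unfolding independence_number_def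
proof (rule Greatest_equality)
  have "(if n < 2 then 0 else (2 * n) choose (n - 2)) < (2 * n) choose n"
    using n binomial_strict_mono [of "n - 2" n "2 * n"] by auto
  then show "basic_betti (heisenberg n) n \<noteq> 0"
    using heis_basic_betti_low [OF n, of n] by simp
next
  fix k assume "basic_betti (heisenberg n) k \<noteq> 0"
  then show "k \<le> n"
    using heis_basic_betti_high [OF n, of k] by (cases "k \<le> n") auto
qed

theorem theorem26:
  fixes n :: nat
  assumes "n \<ge> 1"
  shows "independence_poly (heisenberg n) =
           (\<Sum>k = 0..n. monom (binom (2 * n) (int k) - binom (2 * n) (int k - 2)) k)"
proof -
  have "int (basic_betti (heisenberg n) k) = binom (2 * n) (int k) - binom (2 * n) (int k - 2)"
    if "k \<le> n" for k
  proof -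
    have "binom (2 * n) (int k - 2) = int (if k < 2 then 0 else (2 * n) choose (k - 2))"
      by (auto simp: binom_def nat_diff_distrib)
    moreover have "binom (2 * n) (int k) = int ((2 * n) choose k)"
      by (simp add: binom_def)
    moreover have "basic_betti (heisenberg n) k + (if k < 2 then 0 else (2 * n) choose (k - 2)) = (2 * n) choose k"
      using heis_basic_betti_low [OF assms, of k] that by simp
    ultimately show ?thesis
      by linarith
  qed
  then show ?thesis
    unfolding independence_poly_def heis_independence_number [OF assms]
    by (intro sum.cong) auto
qed

end
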